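(* Let $h\colon S^1\to S^1$ be an orientation-preserving homeomorphism and suppose that there exists a non-negative function $g\in L^1([0,2\pi])$ such that $$\rho_h^c(\theta,t) = O\left( \log \left(\frac{1+g(\theta)}{t} \right)\right)\quad\text{as } t\to 0,$$ uniformly in $\theta$; that is, there exist constants $M>0$ and $t_0\in(0,\pi/2)$ such that $\rho_h^c(\theta,t)\le M\log\left(\frac{1+g(\theta)}{t}\right)$ for all $\theta\in[0,2\pi]$ and $t\in(0,t_0)$. Then there exists an extension of $h$ to a homeomorphism of $\mathbb{D}$ that has exponentially integrable distortion.
   Context: $\mathbb{D}$ is the open unit disk in the plane and $S^1=\partial\mathbb{D}$. For $a,b\in S^1$, $\ell(a,b)$ denotes the length of the arc of the circle that connects $a$ to $b$ in the positive orientation. For an orientation-preserving homeomorphism $h\colon S^1\to S^1$, the circular symmetric distortion function is $$\rho_h^c(\theta,t)= \max \left\{ \frac{\ell(h(e^{i\theta}),h(e^{i(\theta+t)}))}{\ell(h(e^{i(\theta-t)}),h(e^{i\theta}))}, \frac{\ell(h(e^{i(\theta-t)}),h(e^{i\theta}))}{\ell(h(e^{i\theta}),h(e^{i(\theta+t)}))} \right\}$$ for $\theta\in[0,2\pi]$ and $t\in(0,\pi/2)$. A homeomorphism $H\colon U\to V$ between open sets $U,V\subset\mathbb{R}^2$ is a mapping of finite distortion if $H$ is orientation-preserving, $H\in W^{1,1}_{\mathrm{loc}}(U)$, the Jacobian $J_H$ lies in $L^1_{\mathrm{loc}}(U)$, and the quasiconformal dilatation $K_H(x,y)=\inf\{K\ge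 1: \|DH(x,y)\|^2\le K J_H(x,y)\}$ (with $\|DH\|$ the operator norm of the differential matrix) is finite a.e. in $U$. It has exponentially integrable distortion if moreover $\int_U e^{pK_H}\,d\sigma<\infty$ for some $p>0$, where $\sigma$ is the spherical measure, $d\sigma=\frac{4\,dx\,dy}{(1+x^2+y^2)^2}$. An extension of $h$ to a homeomorphism of $\mathbb{D}$ is a homeomorphism $H\colon\overline{\mathbb{D}}\to\overline{\mathbb{D}}$ with $H(\mathbb{D})=\mathbb{D}$ and $H|_{S^1}=h$; the distortion condition refers to $H|_{\mathbb{D}}$. *)

theory Defs
  imports "HOL-Complex_Analysis.Complex_Analysis"
begin

definition homeomorphism_map :: "complex set \<Rightarrow> complex set \<Rightarrow> (complex \<Rightarrow> complex) \<Rightarrow> bool" where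
  "homeomorphism_map S T f \<longleftrightarrow> (\<exists>f'. homeomorphism S T f f')"

(* Orientation of a circle homeomorphism: degree +1. *)

definition circle_homeo_op :: "(complex \<Rightarrow> complex) \<Rightarrow> bool" where
  "circle_homeo_op h \<longleftrightarrow>
     homeomorphism_map (sphere 0 1) (sphere 0 1) h \<and>
     winding_number (h \<circ> circlepath 0 1) 0 = 1"

(* Orientation of a planar homeomorphism: local degree +1 at every point. *)

definition orientation_preserving_on :: "complex set \<Rightarrow> (complex \<Rightarrow> complex) \<Rightarrow> bool" where
  "orientation_preserving_on U H \<longleftrightarrow>
     (\<forall>z r. 0 < r \<and> cball z r \<subseteq> U \<longrightarrow> winding_number (H \<circ> circlepath z r) (H z) = 1)"

(* For a, b on the unit circle, b / a = cis s, where s in [0, 2 pi) is the length of the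
   positively oriented arc from a to b; the value is 0 for a = b. *)

definition arc_len :: "complex \<Rightarrow> complex \<Rightarrow> real" where
  "arc_len a b = Arg2pi (b / a)"

definition circ_distortion :: "(complex \<Rightarrow> complex) \<Rightarrow> real \<Rightarrow> real \<Rightarrow> real" where
  "circ_distortion h \<theta> t =
     max (arc_len (h (cis \<theta>)) (h (cis (\<theta> + t))) / arc_len (h (cis (\<theta> - t))) (h (cis \<theta>)))
         (arc_len (h (cis (\<theta> - t))) (h (cis \<theta>)) / arc_len (h (cis \<theta>)) (h (cis (\<theta> + t))))"

(* The Basis of the type complex is {1, i}, so these are the x- and y-partial derivatives. *)

primrec Ck :: "nat \<Rightarrow> (complex \<Rightarrow> real) \<Rightarrow> bool" where
  "Ck 0 \<phi> \<longleftrightarrow> continuous_on UNIV \<phi>"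
| "Ck (Suc k) \<phi> \<longleftrightarrow>
     (\<forall>z. \<phi> differentiable (at z)) \<and>
     (\<forall>v\<in>Basis. Ck k (\<lambda>z. frechet_derivative \<phi> (at z) v))"

definition test_function :: "complex set \<Rightarrow> (complex \<Rightarrow> real) \<Rightarrow> bool" where
  "test_function U \<phi> \<longleftrightarrow>
     (\<forall>k. Ck k \<phi>) \<and> compact (closure {z. \<phi> z \<noteq> 0}) \<and> closure {z. \<phi> z \<noteq> 0} \<subseteq> U"

definition locally_integrable_on :: "complex set \<Rightarrow> (complex \<Rightarrow> 'a::euclidean_space) \<Rightarrow> bool" where
  "locally_integrable_on U f \<longleftrightarrow>
     (\<forall>K. compact K \<and> K \<subseteq> U \<longrightarrow> f absolutely_integrable_on K)"

(* D is a weak differential of f on U with locally integrable entries: D z v is the weak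
   derivative of f in direction v. It is unique up to a null set. *)

definition weak_differential ::
    "complex set \<Rightarrow> (complex \<Rightarrow> complex) \<Rightarrow> (complex \<Rightarrow> complex \<Rightarrow>\<^sub>L complex) \<Rightarrow> bool" where
  "weak_differential U f D \<longleftrightarrow>
     (\<forall>v\<in>Basis.
        locally_integrable_on U (\<lambda>z. blinfun_apply (D z) v) \<and>
        (\<forall>\<phi>. test_function U \<phi> \<longrightarrow>
           (LINT z:U|lebesgue. frechet_derivative \<phi> (at z) v *\<^sub>R f z) =
           - (LINT z:U|lebesgue. \<phi> z *\<^sub>R blinfun_apply (D z) v)))"

definition sobolev_W11_loc :: "complex set \<Rightarrow> (complex \<Rightarrow> complex) \<Rightarrow> bool" where
  "sobolev_W11_loc U f \<longleftrightarrow> locally_integrable_on U f \<and> (\<exists>D. weak_differential U f D)"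

(* The columns of the matrix of A are A 1 and A i. *)

definition jac :: "complex \<Rightarrow>\<^sub>L complex \<Rightarrow> real" where
  "jac A = Re (blinfun_apply A 1) * Im (blinfun_apply A \<i>)
         - Re (blinfun_apply A \<i>) * Im (blinfun_apply A 1)"

(* The norm on bounded linear maps is the operator norm; the infimum of the empty set is infinite. *)

definition qc_dilatation :: "complex \<Rightarrow>\<^sub>L complex \<Rightarrow> ennreal" where
  "qc_dilatation A = Inf {ennreal K | K. 1 \<le> K \<and> (norm A)\<^sup>2 \<le> K * jac A}"

(* The value of exp (p * K) for p > 0 and K possibly infinite. *)

definition ennreal_exp :: "real \<Rightarrow> ennreal \<Rightarrow> ennreal" where
  "ennreal_exp p K = (if K = \<infinity> then \<infinity> else ennreal (exp (p * enn2real K)))"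

definition spherical_measure :: "complex measure" where
  "spherical_measure = density lebesgue (\<lambda>z. ennreal (4 / (1 + (norm z)\<^sup>2)\<^sup>2))"

definition finite_distortion_map :: "complex set \<Rightarrow> complex set \<Rightarrow> (complex \<Rightarrow> complex) \<Rightarrow> bool" where
  "finite_distortion_map U V H \<longleftrightarrow>
     open U \<and> open V \<and> homeomorphism_map U V H \<and> orientation_preserving_on U H \<and>
     sobolev_W11_loc U H \<and>
     (\<exists>D. weak_differential U H D \<and>
          locally_integrable_on U (\<lambda>z. jac (D z)) \<and>
          (AE z in lebesgue. z \<in> U \<longrightarrow> qc_dilatation (D z) < \<infinity>))"

(* By uniqueness of the weak differential the choice of D below is immaterial. *)

definition exp_integrable_distortion :: "complex set \<Rightarrow> complex set \<Rightarrow> (complex \<Rightarrow> complex) \<Rightarrow> bool" where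
  "exp_integrable_distortion U V H \<longleftrightarrow>
     finite_distortion_map U V H \<and>
     (\<exists>D p. weak_differential U H D \<and> 0 < p \<and>
        (\<integral>\<^sup>+z\<in>U. ennreal_exp p (qc_dilatation (D z)) \<partial>spherical_measure) < \<infinity>)"

definition disk_extension :: "(complex \<Rightarrow> complex) \<Rightarrow> (complex \<Rightarrow> complex) \<Rightarrow> bool" where
  "disk_extension h H \<longleftrightarrow>
     homeomorphism_map (cball 0 1) (cball 0 1) H \<and> H ` ball 0 1 = ball 0 1 \<and>
     (\<forall>z\<in>sphere 0 1. H z = h z)"

end

theory Submission
  imports Defs
begin

text \<open>
  The extension is that of Beurling and Ahlfors. Let \<open>f\<close> be an increasing lift of \<open>h\<close>, so that
  \<open>h (cis x) = cis (f x)\<close> and \<open>f (x + 2 * pi) = f x + 2 * pi\<close>. A point \<open>x + \<i> y\<close> of the closed upper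
  half-plane is sent to the point whose real part is half the sum, and whose imaginary part is the
  difference, of the mean of \<open>f\<close> over \<open>{x..x + y}\<close> and its mean over \<open>{x - y..x}\<close>. This map \<open>BA\<close>
  extends \<open>f\<close>, commutes with the translation by \<open>2 * pi\<close>, is \<open>C\<^sup>1\<close> in the open half-plane, and is
  injective because a mean of an increasing function increases with both end points. On the line
  \<open>Im w = 2 * pi\<close> the means are taken over whole periods, so there \<open>BA\<close> is a real translation.
  Continuing it by this translation above the line and passing to the disk by \<open>w \<mapsto> exp (\<i> * w)\<close> gives a
  map \<open>disk_ext\<close> of the closed disk which is a rotation near \<open>0\<close>: no singularity appears at
  the centre. Invariance of domain makes it a homeomorphism, and shrinking circles inside the disk
  shows that all its local degrees agree with the degree of \<open>h\<close>.

  Away from the circle \<open>norm z = core_radius\<close> the map \<open>disk_ext\<close> is \<open>C\<^sup>1\<close>, and its derivative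
  \<open>disk_diff\<close> has one-sided limits at this circle. A horizontal or vertical line meets the circle in
  at most two points, so the fundamental theorem of calculus on lines and Fubini's theorem make
  \<open>disk_diff\<close> a weak differential (\<open>weak_differential_of_line_derivatives\<close>).

  The exponential and its inverse are conformal, so the dilatation can be computed for \<open>BA\<close>. At
  \<open>x + \<i> y\<close> it is at most a constant times either the symmetric distortion of \<open>f\<close> at \<open>(x, y)\<close>, or its
  value at \<open>(x \<plusminus> s y, (1/2 + s) y)\<close> for whichever \<open>s\<close> between \<open>1/8\<close> and \<open>1/4\<close> one likes
  (\<open>dilatation_BA_le_distortion\<close>). In the first case the hypothesis bounds the dilatation by a
  multiple of \<open>ln ((1 + g x) / y)\<close>. In the second case \<open>s\<close> can be chosen so that \<open>g\<close> is at most its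
  mean over an interval of length \<open>y / 8\<close>, hence \<open>O(1 / y)\<close>, and the bound is a multiple of
  \<open>ln (C / y\<^sup>2)\<close>. For a small exponent \<open>p\<close> the exponential of \<open>p\<close> times the dilatation is therefore at
  most a constant times \<open>(1 + g x) * y powr (-1/2)\<close> (\<open>exp_dilatation_BA_bound\<close>), and this is integrable
  over the disk because \<open>g\<close> is integrable in the angle and \<open>y powr (-1/2)\<close> in the radius.
\<close>

section \<open>Increasing lifts of circle homeomorphisms\<close>

lemma continuous_Ints_valued_constant:
  fixes f :: "'a::topological_space \<Rightarrow> real"
  assumes "connected S" "continuous_on S f" "\<And>x. x \<in> S \<Longrightarrow> f x \<in> \<int>"
  shows "f constant_on S"
proof (rule continuous_discrete_range_constant[OF assms(1,2)])
  fix x assume "x \<in> S"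
  have "1 \<le> norm (f y - f x)" if "y \<in> S" "f y \<noteq> f x" for y
    using Ints_nonzero_abs_ge1[of "f y - f x"] assms(3) that \<open>x \<in> S\<close> by auto
  then show "\<exists>e>0. \<forall>y. y \<in> S \<and> f y \<noteq> f x \<longrightarrow> e \<le> norm (f y - f x)"
    by (intro exI[of _ 1]) auto
qed

lemma cis_eq_iff_Ints: "cis a = cis b \<longleftrightarrow> (a - b) / (2 * pi) \<in> \<int>"
proof -
  have "cis a = cis b \<longleftrightarrow> exp (\<i> * a) = exp (\<i> * b)"
    by (simp add: cis_conv_exp)
  also have "\<dots> \<longleftrightarrow> (\<exists>n::int. \<i> * a = \<i> * b + of_real (of_int n * (2 * pi)) * \<i>)"
    by (simp add: exp_eq mult.commute mult.left_commute)
  also have "\<dots> \<longleftrightarrow> (\<exists>n::int. a = b + of_int n * (2 * pi))"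
    by (simp add: complex_eq_iff)
  also have "\<dots> \<longleftrightarrow> (a - b) / (2 * pi) \<in> \<int>"
    by (auto simp: Ints_def image_iff field_simps)
  finally show ?thesis .
qed

text \<open>
  The winding number decides the increment of a continuous lift over one period: it is \<open>2 * pi\<close>.
  Injectivity of \<open>h\<close> on the circle then makes the lift injective, hence strictly monotone, and the sign
  of the increment leaves only the increasing case.
\<close>

lemma circle_homeo_lift:
  assumes "circle_homeo_op h"
  obtains f :: "real \<Rightarrow> real" where "continuous_on UNIV f" "strict_mono f"
    "\<And>x. f (x + 2 * pi) = f x + 2 * pi" "\<And>x. h (cis x) = cis (f x)"
proof -
  from assms obtain h' where hom: "homeomorphism (sphere 0 1) (sphere 0 1) h h'"
    and wn: "winding_number (h \<circ> circlepath 0 1) 0 = 1"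
    unfolding circle_homeo_op_def homeomorphism_map_def by blast
  have conth: "continuous_on (sphere 0 1) h" and imh: "h ` sphere 0 1 = sphere 0 1"
    using hom by (auto simp: homeomorphism_def)
  have injh: "inj_on h (sphere 0 1)"
    using hom by (metis homeomorphism_def inj_on_inverseI)
  have norm_h: "norm (h (cis x)) = 1" for x
    using imh by (force simp: image_iff set_eq_iff)
  have cont: "continuous_on UNIV (\<lambda>x. h (cis x))"
    by (rule continuous_on_compose2[OF conth]) (auto intro!: continuous_intros)
  obtain G where contG: "continuous_on UNIV G" and G: "\<And>x::real. h (cis x) = exp (G x)"
    using continuous_logarithm_on_contractible[OF cont convex_imp_contractible[OF convex_UNIV]]
      norm_h by (metis UNIV_I norm_zero zero_neq_one)
  define f where "f x = Im (G x)" for x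
  have ReG: "Re (G x) = 0" for x
    using norm_h[of x] by (simp add: G)
  have hf: "h (cis x) = cis (f x)" for x
    using ReG[of x] by (simp add: G f_def exp_eq_polar)
  have contf: "continuous_on UNIV f"
    unfolding f_def by (intro continuous_intros contG)
  have Ints: "(f x - f y) / (2 * pi) \<in> \<int> \<longleftrightarrow> (x - y) / (2 * pi) \<in> \<int>" for x y
    using injh by (simp add: cis_eq_iff_Ints[symmetric] hf[symmetric] inj_on_eq_iff)
  have "(\<lambda>x. (f (x + 2 * pi) - f x) / (2 * pi)) constant_on UNIV"
  proof (rule continuous_Ints_valued_constant)
    show "continuous_on UNIV (\<lambda>x. (f (x + 2 * pi) - f x) / (2 * pi))"
      by (intro continuous_intros continuous_on_compose2[OF contf]) auto
    show "(f (x + 2 * pi) - f x) / (2 * pi) \<in> \<int>" for x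
      by (simp add: Ints)
  qed auto
  then obtain k where k: "\<And>x. (f (x + 2 * pi) - f x) / (2 * pi) = k"
    unfolding constant_on_def by auto
  define p where "p = h \<circ> circlepath 0 1"
  have p_eq: "p t = cis (f (2 * pi * t))" for t
  proof -
    have "circlepath 0 1 t = cis (2 * pi * t)"
      by (simp add: circlepath cis_conv_exp mult_ac)
    then show ?thesis by (simp add: p_def hf)
  qed
  have "path p"
    unfolding path_def p_eq
    by (intro continuous_intros continuous_on_compose2[OF contf]) auto
  moreover have "0 \<notin> path_image p"
    by (auto simp: path_image_def p_eq)
  ultimately obtain q where q: "path q"
      "pathfinish q - pathstart q = 2 * of_real pi * \<i> * winding_number p 0"
      "\<And>t. t \<in> {0..1} \<Longrightarrow> p t = 0 + exp (q t)"
    using winding_number_as_continuous_log by blast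
  \<comment> \<open>\<open>q\<close> and \<open>f\<close> lift the same loop, so they have the same increment over it\<close>
  have "(\<lambda>t. (Im (q t) - f (2 * pi * t)) / (2 * pi)) constant_on {0..1}"
  proof (rule continuous_Ints_valued_constant)
    show "continuous_on {0..1} (\<lambda>t. (Im (q t) - f (2 * pi * t)) / (2 * pi))"
      using q(1) unfolding path_def
      by (intro continuous_intros continuous_on_compose2[OF contf]) auto
    fix t :: real assume t: "t \<in> {0..1}"
    have "exp (q t) = cis (f (2 * pi * t))"
      using q(3)[OF t] p_eq by simp
    moreover from this have "norm (exp (q t)) = 1" by simp
    then have "Re (q t) = 0" by simp
    ultimately have "cis (Im (q t)) = cis (f (2 * pi * t))"
      by (simp add: exp_eq_polar)
    then show "(Im (q t) - f (2 * pi * t)) / (2 * pi) \<in> \<int>"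
      by (simp add: cis_eq_iff_Ints)
  qed auto
  then obtain d where d: "\<And>t. t \<in> {0..1} \<Longrightarrow> (Im (q t) - f (2 * pi * t)) / (2 * pi) = d"
    unfolding constant_on_def by auto
  have "Im (q 1) - Im (q 0) = 2 * pi"
    using q(2) wn by (simp add: p_def pathfinish_def pathstart_def complex_eq_iff)
  moreover have "Im (q 1) - f (2 * pi) = Im (q 0) - f 0"
    using d[of 1] d[of 0] by (auto simp: divide_eq_eq)
  ultimately have "f (0 + 2 * pi) - f 0 = 2 * pi"
    by simp
  then have "k = 1"
    using k[of 0] by simp
  then have period: "f (x + 2 * pi) = f x + 2 * pi" for x
    using k[of x] by (simp add: field_simps)
  have period_nat: "f (x + 2 * pi * of_nat n) = f x + 2 * pi * of_nat n" for x n
    by (induction n) (use period in \<open>auto simp: algebra_simps\<close>,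
        metis add.assoc add.commute period)
  have period_int: "f (x + 2 * pi * of_int n) = f x + 2 * pi * of_int n" for x n
  proof (cases n rule: int_cases2)
    case (nonneg m) then show ?thesis using period_nat[of x m] by simp
  next
    case (nonpos m)
    then show ?thesis using period_nat[of "x - 2 * pi * of_nat m" m] by simp
  qed
  have "inj f"
  proof (rule injI)
    fix x y assume "f x = f y"
    then have "(x - y) / (2 * pi) \<in> \<int>" using Ints[of x y] by simp
    then obtain n where "(x - y) / (2 * pi) = of_int n" by (auto elim: Ints_cases)
    then have n: "x = y + 2 * pi * of_int n" by (simp add: field_simps)
    with \<open>f x = f y\<close> period_int[of y n] have "n = 0" by simp
    with n show "x = y" by simp
  qed
  then have "strict_mono f \<or> strict_antimono_on UNIV f"
    using injective_eq_monotone_map[of UNIV f] contf by simp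
  moreover have "\<not> strict_antimono_on UNIV f"
  proof
    assume "strict_antimono_on UNIV f"
    then have "f (0 + 2 * pi) < f 0" by (auto simp: monotone_on_def)
    then show False using period[of 0] by simp
  qed
  ultimately show ?thesis
    using that contf period hf by blast
qed

section \<open>The Beurling--Ahlfors extension of a lift\<close>

text \<open>
  The mean of \<open>f\<close> over the interval between \<open>a\<close> and \<open>b\<close>, parametrised over \<open>{0..1}\<close> so that it is
  continuous up to \<open>a = b\<close>, where it takes the value \<open>f a\<close>.
\<close>

definition line_mean :: "(real \<Rightarrow> real) \<Rightarrow> real \<Rightarrow> real \<Rightarrow> real" where
  "line_mean f a b = integral {0..1} (\<lambda>t. f (a + t * (b - a)))"

lemma continuous_line_mean:
  assumes "continuous_on UNIV f"
  shows "continuous_on UNIV (\<lambda>p. line_mean f (fst p) (snd p))"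
proof -
  have "continuous_on UNIV (\<lambda>p. integral (cbox 0 1) (\<lambda>t. f (fst p + t * (snd p - fst p))))"
    by (rule integral_continuous_on_param)
      (auto simp: case_prod_unfold intro!: continuous_intros continuous_on_compose2[OF assms])
  then show ?thesis
    by (simp add: line_mean_def)
qed

lemma line_mean_same [simp]: "line_mean f a a = f a"
  by (simp add: line_mean_def)

text \<open>
  The integrands are ordered pointwise and differ at \<open>t = 1/2\<close>.
\<close>

lemma line_mean_strict_mono:
  assumes cont: "continuous_on UNIV f" and mono: "strict_mono f"
    and le: "a \<le> a'" "b \<le> b'" and ne: "a < a' \<or> b < b'"
  shows "line_mean f a b < line_mean f a' b'"
proof -
  define d where "d t = f (a' + t * (b' - a')) - f (a + t * (b - a))" for t
  have le_args: "a + t * (b - a) \<le> a' + t * (b' - a')" if "t \<in> {0..1}" for t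
  proof -
    have "0 \<le> (1 - t) * (a' - a) + t * (b' - b)"
      using that le by simp
    then show ?thesis by (simp add: algebra_simps)
  qed
  have nonneg: "0 \<le> d t" if "t \<in> {0..1}" for t
    using le_args[OF that] strict_mono_mono[OF mono] by (simp add: d_def monoD)
  have contd: "continuous_on {0..1} d"
    unfolding d_def by (intro continuous_intros continuous_on_compose2[OF cont]) auto
  have "d (1/2) > 0"
    using ne le strict_monoD[OF mono, of "a + 1/2 * (b - a)" "a' + 1/2 * (b' - a')"]
    by (auto simp: d_def field_simps)
  then have "integral {0..1} d \<noteq> 0"
    using integral_eq_0_iff[OF contd _ nonneg] by force
  moreover have "0 \<le> integral {0..1} d"
    by (intro integral_nonneg integrable_continuous_real contd nonneg)
  ultimately have "0 < integral {0..1} d" by linarith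
  also have "integral {0..1} d = line_mean f a' b' - line_mean f a b"
    unfolding d_def line_mean_def
    by (intro integral_diff integrable_continuous_real continuous_intros
        continuous_on_compose2[OF cont]) auto
  finally show ?thesis by simp
qed

lemma line_mean_antiderivative:
  assumes \<Phi>: "\<And>x. (\<Phi> has_real_derivative f x) (at x)"
  shows "(b - a) * line_mean f a b = \<Phi> b - \<Phi> a"
proof -
  have "((\<lambda>t. (b - a) * f (a + t * (b - a))) has_integral
      \<Phi> (a + 1 * (b - a)) - \<Phi> (a + 0 * (b - a))) {0..1}"
  proof (rule fundamental_theorem_of_calculus)
    fix t :: real
    have "((\<lambda>t. \<Phi> (a + t * (b - a))) has_real_derivative f (a + t * (b - a)) * (b - a))
        (at t within {0..1})"
      by (rule DERIV_chain2[OF \<Phi>]) (auto intro!: derivative_eq_intros)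
    then show "((\<lambda>t. \<Phi> (a + t * (b - a))) has_vector_derivative (b - a) * f (a + t * (b - a)))
        (at t within {0..1})"
      by (simp add: has_real_derivative_iff_has_vector_derivative mult.commute)
  qed simp
  from integral_unique[OF this] show ?thesis
    by (simp add: line_mean_def)
qed

lemma continuous_imp_antiderivative:
  fixes f :: "real \<Rightarrow> real"
  assumes "continuous_on UNIV f"
  obtains \<Phi> where "\<And>x. (\<Phi> has_real_derivative f x) (at x)"
proof -
  have "\<exists>F. \<forall>x::real. -\<infinity> < ereal x \<longrightarrow> ereal x < \<infinity> \<longrightarrow> (F has_vector_derivative f x) (at x)"
    by (rule einterval_antiderivative)
      (use assms in \<open>auto simp: continuous_on_eq_continuous_at\<close>)
  then show ?thesis
    using that by (auto simp: has_real_derivative_iff_has_vector_derivative)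
qed

locale circle_lift =
  fixes f :: "real \<Rightarrow> real"
  assumes cont_f: "continuous_on UNIV f"
    and mono_f: "strict_mono f"
    and period_f: "f (x + 2 * pi) = f x + 2 * pi"
begin

definition right_mean :: "complex \<Rightarrow> real" where
  "right_mean w = line_mean f (Re w) (Re w + Im w)"

definition left_mean :: "complex \<Rightarrow> real" where
  "left_mean w = line_mean f (Re w - Im w) (Re w)"

text \<open>
  The imaginary part is the full difference of the means, so that the line at height \<open>2 * pi\<close>, where
  the means run over whole periods, is mapped to itself.
\<close>

definition BA :: "complex \<Rightarrow> complex" where
  "BA w = Complex ((right_mean w + left_mean w) / 2) (right_mean w - left_mean w)"

text \<open>
  Up to the factor \<open>1 / Im w\<close>, the next four quantities are the absolute values of the partial
  derivatives of the two means.
\<close>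

definition right_incr :: "complex \<Rightarrow> real" where
  "right_incr w = f (Re w + Im w) - f (Re w)"

definition left_incr :: "complex \<Rightarrow> real" where
  "left_incr w = f (Re w) - f (Re w - Im w)"

definition right_gap :: "complex \<Rightarrow> real" where
  "right_gap w = f (Re w + Im w) - right_mean w"

definition left_gap :: "complex \<Rightarrow> real" where
  "left_gap w = left_mean w - f (Re w - Im w)"

definition dright :: "complex \<Rightarrow> complex \<Rightarrow> real" where
  "dright w \<zeta> = (Re \<zeta> * right_incr w + Im \<zeta> * right_gap w) / Im w"

definition dleft :: "complex \<Rightarrow> complex \<Rightarrow> real" where
  "dleft w \<zeta> = (Re \<zeta> * left_incr w - Im \<zeta> * left_gap w) / Im w"

definition dBA :: "complex \<Rightarrow> complex \<Rightarrow> complex" where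
  "dBA w \<zeta> = Complex ((dright w \<zeta> + dleft w \<zeta>) / 2) (dright w \<zeta> - dleft w \<zeta>)"

lemma cont_right_mean: "continuous_on UNIV right_mean"
  unfolding right_mean_def
  using continuous_on_compose2[OF continuous_line_mean[OF cont_f],
      of UNIV "\<lambda>w. (Re w, Re w + Im w)"]
  by (simp add: continuous_intros)

lemma cont_left_mean: "continuous_on UNIV left_mean"
  unfolding left_mean_def
  using continuous_on_compose2[OF continuous_line_mean[OF cont_f],
      of UNIV "\<lambda>w. (Re w - Im w, Re w)"]
  by (simp add: continuous_intros)

lemma cont_BA: "continuous_on UNIV BA"
  unfolding BA_def Complex_eq
  by (intro continuous_intros cont_right_mean cont_left_mean) auto

lemma cont_f_compose: "continuous_on S u \<Longrightarrow> continuous_on S (\<lambda>x. f (u x))"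
  by (rule continuous_on_compose2[OF cont_f]) auto

lemma cont_incr_gap:
  "continuous_on UNIV right_incr" "continuous_on UNIV left_incr"
  "continuous_on UNIV right_gap" "continuous_on UNIV left_gap"
  unfolding right_incr_def left_incr_def right_gap_def left_gap_def
  by (intro continuous_intros cont_f_compose cont_right_mean cont_left_mean)+

lemma cont_dBA: "continuous_on {w. 0 < Im w} (\<lambda>w. dBA w (u w))"
  if "continuous_on {w. 0 < Im w} u"
  unfolding dBA_def Complex_eq dright_def dleft_def
  by (intro continuous_intros that continuous_on_subset[OF cont_incr_gap(1)]
      continuous_on_subset[OF cont_incr_gap(2)] continuous_on_subset[OF cont_incr_gap(3)]
      continuous_on_subset[OF cont_incr_gap(4)]) auto

lemma line_mean_less: "a \<le> a' \<Longrightarrow> b \<le> b' \<Longrightarrow> a < a' \<or> b < b' \<Longrightarrow> line_mean f a b < line_mean f a' b'"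
  by (rule line_mean_strict_mono[OF cont_f mono_f])

lemma incr_gap_pos:
  assumes "0 < Im w"
  shows "0 < right_incr w" "0 < left_incr w" "0 < right_gap w" "0 < left_gap w"
  using assms strict_monoD[OF mono_f] line_mean_less[of "Re w" "Re w + Im w" "Re w + Im w" "Re w + Im w"]
    line_mean_less[of "Re w - Im w" "Re w - Im w" "Re w - Im w" "Re w"]
  by (auto simp: right_incr_def left_incr_def right_gap_def left_gap_def right_mean_def left_mean_def)

lemma gap_less_incr:
  assumes "0 < Im w"
  shows "right_gap w < right_incr w" "left_gap w < left_incr w"
  using assms line_mean_less[of "Re w" "Re w" "Re w" "Re w + Im w"]
    line_mean_less[of "Re w - Im w" "Re w" "Re w" "Re w"]
  by (auto simp: right_incr_def left_incr_def right_gap_def left_gap_def right_mean_def left_mean_def)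

lemma has_derivative_means:
  assumes w: "0 < Im w"
  shows "(right_mean has_derivative dright w) (at w)" "(left_mean has_derivative dleft w) (at w)"
proof -
  obtain \<Phi> where \<Phi>: "\<And>x. (\<Phi> has_real_derivative f x) (at x)"
    using continuous_imp_antiderivative[OF cont_f] by blast
  have \<Phi>': "((\<lambda>w. \<Phi> (u w)) has_derivative (\<lambda>\<zeta>. f (u w) * u' \<zeta>)) (at w)"
    if "(u has_derivative u') (at w)" for u u'
    using has_derivative_compose[OF that, of \<Phi> "(*) (f (u w))"] \<Phi>[of "u w"]
    by (simp add: has_field_derivative_def)
  have ev: "\<forall>\<^sub>F z in nhds w. 0 < Im z"
    using w by (intro order_tendstoD[of Im "Im w"] filterlim_ident tendsto_Im)
  have eqR: "(\<Phi> (Re z + Im z) - \<Phi> (Re z)) / Im z = right_mean z" if "0 < Im z" for z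
    using line_mean_antiderivative[OF \<Phi>, of "Re z + Im z" "Re z"] that
    by (simp add: right_mean_def field_simps)
  have eqL: "(\<Phi> (Re z) - \<Phi> (Re z - Im z)) / Im z = left_mean z" if "0 < Im z" for z
    using line_mean_antiderivative[OF \<Phi>, of "Re z" "Re z - Im z"] that
    by (simp add: left_mean_def field_simps)
  have PR: "\<Phi> (Re w + Im w) - \<Phi> (Re w) = Im w * right_mean w"
    and PL: "\<Phi> (Re w) - \<Phi> (Re w - Im w) = Im w * left_mean w"
    using eqR[OF w] eqL[OF w] w by (auto simp: field_simps)
  have "((\<lambda>z. (\<Phi> (Re z + Im z) - \<Phi> (Re z)) / Im z) has_derivative dright w) (at w)"
    apply (rule has_derivative_eq_rhs)
     apply (rule derivative_intros \<Phi>')+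
    using w PR
    apply (auto simp: dright_def right_incr_def right_gap_def fun_eq_iff)
    apply (simp add: divide_simps, simp add: algebra_simps)
    done
  then show "(right_mean has_derivative dright w) (at w)"
    by (rule has_derivative_transform_eventually)
      (use ev w eqR in \<open>auto simp: eventually_nhds_conv_at elim!: eventually_mono\<close>)
  have "((\<lambda>z. (\<Phi> (Re z) - \<Phi> (Re z - Im z)) / Im z) has_derivative dleft w) (at w)"
    apply (rule has_derivative_eq_rhs)
     apply (rule derivative_intros \<Phi>')+
    using w PL
    apply (auto simp: dleft_def left_incr_def left_gap_def fun_eq_iff)
    apply (simp add: divide_simps, simp add: algebra_simps)
    done
  then show "(left_mean has_derivative dleft w) (at w)"
    by (rule has_derivative_transform_eventually)
      (use ev w eqL in \<open>auto simp: eventually_nhds_conv_at elim!: eventually_mono\<close>)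
qed

lemma has_derivative_BA:
  assumes w: "0 < Im w"
  shows "(BA has_derivative dBA w) (at w)"
  unfolding BA_def dBA_def Complex_eq
  by (intro has_derivative_add has_derivative_of_real has_derivative_mult_right
      has_derivative_diff bounded_linear.has_derivative[OF bounded_linear_divide]
      has_derivative_means[OF w])

text \<open>
  If two points have the same right means and the first has the smaller real part, then the right
  interval of the first must end later; equality of the left means forces the left interval of the
  first to begin later. Together these contradict the order of the real parts. Points with the same
  real part are separated by the right mean.
\<close>

lemma inj_on_BA: "inj_on BA {w. 0 \<le> Im w}"
proof -
  have *: False if "0 \<le> Im w" "0 \<le> Im z" "BA w = BA z" "Re w < Re z" for w z
  proof -
    from that have eq: "right_mean w = right_mean z" "left_mean w = left_mean z"
      by (auto simp: BA_def)
    have "Re w + Im w > Re z + Im z"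
      using line_mean_less[of "Re w" "Re z" "Re w + Im w" "Re z + Im z"] eq(1) that(4)
      unfolding right_mean_def by linarith
    moreover have "Re w - Im w > Re z - Im z"
      using line_mean_less[of "Re w - Im w" "Re z - Im z" "Re w" "Re z"] eq(2) that(4)
      unfolding left_mean_def by linarith
    ultimately show False using that(4) by linarith
  qed
  have **: False if "0 \<le> Im w" "0 \<le> Im z" "BA w = BA z" "Re w = Re z" "Im w < Im z" for w z
    using line_mean_less[of "Re w" "Re z" "Re w + Im w" "Re z + Im z"] that
    by (simp add: BA_def right_mean_def)
  show ?thesis
  proof (rule inj_onI, rule ccontr)
    fix w z assume wz: "w \<in> {w. 0 \<le> Im w}" "z \<in> {w. 0 \<le> Im w}" "BA w = BA z" "w \<noteq> z"
    then consider "Re w < Re z" | "Re z < Re w" | "Re w = Re z" "Im w < Im z" | "Re w = Re z" "Im z < Im w"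
      by (metis complex_eqI linorder_neqE_linordered_idom)
    then show False
      using *[of w z] *[of z w] **[of w z] **[of z w] wz by cases auto
  qed
qed

lemma line_mean_period: "line_mean f (a + 2 * pi) (b + 2 * pi) = line_mean f a b + 2 * pi"
proof -
  have "f (a + 2 * pi + t * (b + 2 * pi - (a + 2 * pi))) = f (a + t * (b - a)) + 2 * pi" for t
    using period_f[of "a + t * (b - a)"] by (simp add: algebra_simps)
  moreover have "integral {0..1} (\<lambda>t. f (a + t * (b - a)) + 2 * pi) =
      integral {0..1} (\<lambda>t. f (a + t * (b - a))) + integral {0..1} (\<lambda>t::real. 2 * pi)"
    by (rule integral_add) (intro integrable_continuous_real continuous_intros cont_f_compose)+
  ultimately show ?thesis
    by (simp add: line_mean_def)
qed

lemma BA_period: "BA ((w::complex) + 2 * pi) = BA w + 2 * pi"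
  using line_mean_period[of "Re w" "Re w + Im w"] line_mean_period[of "Re w - Im w" "Re w"]
  by (simp add: BA_def right_mean_def left_mean_def complex_eq_iff algebra_simps)

lemma dBA_period: "dBA ((w::complex) + 2 * pi) \<zeta> = dBA w \<zeta>"
  using line_mean_period[of "Re w" "Re w + Im w"] line_mean_period[of "Re w - Im w" "Re w"]
    period_f[of "Re w"] period_f[of "Re w + Im w"] period_f[of "Re w - Im w"]
  by (simp add: dBA_def dright_def dleft_def right_incr_def left_incr_def right_gap_def left_gap_def
      right_mean_def left_mean_def complex_eq_iff algebra_simps)

lemma BA_real: "BA (of_real x) = of_real (f x)"
  by (simp add: BA_def right_mean_def left_mean_def complex_eq_iff)

text \<open>
  The translation that \<open>BA\<close> induces on the line at height \<open>2 * pi\<close>.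
\<close>

definition shift :: real where
  "shift = Re (BA (\<i> * (2 * pi)))"

text \<open>
  At height \<open>2 * pi\<close> the increments of \<open>f\<close> that give the horizontal derivatives of the two means are
  exactly \<open>2 * pi\<close>, so both means have horizontal derivative 1.
\<close>

lemma BA_top:
  assumes "Im w = 2 * pi"
  shows "BA w = w + of_real shift"
proof -
  have LR: "left_mean w = right_mean w - 2 * pi" if "Im w = 2 * pi" for w
    using line_mean_period[of "Re w - 2 * pi" "Re w"] that
    by (simp add: left_mean_def right_mean_def)
  define r where "r x = right_mean (Complex x (2 * pi))" for x
  have "((\<lambda>x. r x - x) has_real_derivative 0) (at x)" for x
  proof -
    have "((\<lambda>x. right_mean (Complex x (2 * pi))) has_derivative
        (\<lambda>t. dright (Complex x (2 * pi)) (of_real t))) (at x)"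
      apply (rule has_derivative_compose[OF _ has_derivative_means(1)])
      unfolding Complex_eq
       apply (rule derivative_eq_intros refl | simp)+
      done
    then have "(r has_real_derivative 1) (at x)"
      unfolding r_def has_field_derivative_def
      by (rule has_derivative_eq_rhs) (use period_f[of x] in \<open>auto simp: dright_def right_incr_def\<close>)
    then show ?thesis by (auto intro!: derivative_eq_intros)
  qed
  then have "r x - x = r 0 - 0" for x
    using DERIV_isconst_all by blast
  from this[of "Re w"] have "right_mean (Complex (Re w) (2 * pi)) = right_mean (Complex 0 (2 * pi)) + Re w"
    by (simp add: r_def)
  moreover have "w = Complex (Re w) (2 * pi)" "\<i> * (2 * pi) = Complex 0 (2 * pi)"
    using assms by (simp_all add: complex_eq_iff)
  ultimately have "right_mean w = right_mean (\<i> * (2 * pi)) + Re w"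
    by simp
  then show ?thesis
    using LR[OF assms] LR[of "\<i> * (2 * pi)"] assms
    by (simp add: BA_def shift_def complex_eq_iff)
qed

lemma Im_BA_pos: "0 < Im w \<Longrightarrow> 0 < Im (BA w)"
  using incr_gap_pos(1)[of w] gap_less_incr[of w]
  by (simp add: BA_def right_gap_def right_incr_def left_gap_def left_incr_def)

lemma Im_BA_less: 
  assumes "Im w < 2 * pi"
  shows "Im (BA w) < 2 * pi"
proof -
  have "right_mean w < right_mean (Complex (Re w) (2 * pi))"
    "left_mean (Complex (Re w) (2 * pi)) < left_mean w"
    using assms by (auto simp: right_mean_def left_mean_def intro!: line_mean_less)
  moreover have "Im (BA (Complex (Re w) (2 * pi))) = 2 * pi"
    by (subst BA_top) auto
  ultimately show ?thesis by (simp add: BA_def)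
qed

end

section \<open>Transfer to the disk\<close>

text \<open>
  By invariance of domain the image of the open disk is open. It is also relatively closed, being the
  trace on the open disk of the compact image of the closed disk; so it is the whole open disk.
\<close>

lemma homeomorphism_disk_from_boundary:
  fixes H :: "complex \<Rightarrow> complex"
  assumes cont: "continuous_on (cball 0 1) H" and inj: "inj_on H (cball 0 1)"
    and bdry: "H ` sphere 0 1 = sphere 0 1" and int: "H ` ball 0 1 \<subseteq> ball 0 1"
  shows "homeomorphism_map (cball 0 1) (cball 0 1) H" "H ` ball 0 1 = ball 0 1"
    "homeomorphism_map (ball 0 1) (ball 0 1) H"
proof -
  have cball_Un: "cball (0::complex) 1 = ball 0 1 \<union> sphere 0 1" by auto
  have "open (H ` ball 0 1)"
    by (rule invariance_of_domain)
      (use cont inj ball_subset_cball in \<open>auto intro: continuous_on_subset inj_on_subset\<close>)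
  moreover have "closedin (top_of_set (ball 0 1)) (H ` ball 0 1)"
  proof -
    have "H ` ball 0 1 = ball 0 1 \<inter> H ` cball 0 1"
      using int bdry unfolding cball_Un image_Un by auto
    moreover have "closed (H ` cball 0 1)"
      by (intro compact_imp_closed compact_continuous_image cont compact_cball)
    ultimately show ?thesis
      by (auto simp: closedin_closed)
  qed
  ultimately show ball: "H ` ball 0 1 = ball 0 1"
    using connected_clopen[of "ball (0::complex) 1"] int
    by (metis connected_ball image_is_empty openin_open_eq open_ball ball_eq_empty not_one_le_zero)
  then have "H ` cball 0 1 = cball 0 1"
    using bdry unfolding cball_Un image_Un by simp
  then obtain g where g: "homeomorphism (cball 0 1) (cball 0 1) H g"
    using homeomorphism_compact[OF compact_cball cont _ inj] by auto
  then show "homeomorphism_map (cball 0 1) (cball 0 1) H"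
    unfolding homeomorphism_map_def by blast
  show "homeomorphism_map (ball 0 1) (ball 0 1) H"
    unfolding homeomorphism_map_def
    using homeomorphism_of_subsets[OF g, of "ball 0 1" "ball 0 1"] ball by auto
qed

text \<open>
  The circle about \<open>z\<close> of radius \<open>r\<close> is deformed linearly, through circles inside the closed disk, to
  the unit circle about \<open>0\<close>. Since \<open>H\<close> is injective, the image of each circle avoids the image of its
  centre, so the winding number about the image of the centre is constant along the deformation.
\<close>

lemma orientation_preserving_from_boundary:
  assumes cont: "continuous_on (cball 0 1) H" and inj: "inj_on H (cball 0 1)"
    and "H 0 = 0" and wn: "winding_number (H \<circ> circlepath 0 1) 0 = 1"
  shows "orientation_preserving_on (ball 0 1) H"
  unfolding orientation_preserving_on_def
proof (intro allI impI, elim conjE)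
  fix z :: complex and r :: real
  assume r: "0 < r" and sub: "cball z r \<subseteq> ball 0 1"
  \<comment> \<open>the circles of the deformation have centre \<open>c s\<close> and radius \<open>\<rho> s\<close>\<close>
  define c where "c s = (1 - s) *\<^sub>R z" for s :: real
  define \<rho> where "\<rho> s = (1 - s) * r + s" for s :: real
  have zr: "norm z + r \<le> 1"
  proof -
    have "cball z r \<subseteq> cball 0 1" using sub by auto
    then show ?thesis using r by (simp add: cball_subset_cball_iff)
  qed
  have \<rho>_pos: "0 < \<rho> s" if "s \<in> {0..1}" for s
    using that r unfolding \<rho>_def
    by (cases "s = 1") (auto intro: add_pos_nonneg)
  have inside: "c s \<in> cball 0 1" "c s + \<rho> s * cis a \<in> cball 0 1" if "s \<in> {0..1}" for s a
  proof -
    have "norm (c s) = (1 - s) * norm z"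
      using that by (simp add: c_def)
    then have "norm (c s) + \<rho> s = (1 - s) * (norm z + r) + s"
      by (simp add: \<rho>_def algebra_simps)
    also have "\<dots> \<le> (1 - s) * 1 + s"
      using that zr by (intro add_mono mult_left_mono) auto
    finally have *: "norm (c s) + \<rho> s \<le> 1" by simp
    then show "c s \<in> cball 0 1" using \<rho>_pos[OF that] by simp
    have "norm (c s + \<rho> s * cis a) \<le> norm (c s) + norm (\<rho> s * cis a)"
      by (rule norm_triangle_ineq)
    then show "c s + \<rho> s * cis a \<in> cball 0 1"
      using * \<rho>_pos[OF that] by (simp add: norm_mult)
  qed
  define K where "K p = H (c (fst p) + \<rho> (fst p) * cis (2 * pi * snd p)) - H (c (fst p))" for p
  have cp: "circlepath u \<rho> t = u + \<rho> * cis (2 * pi * t)" for u \<rho> t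
    by (simp add: circlepath cis_conv_exp mult_ac)
  have contK: "continuous_on ({0..1} \<times> {0..1}) K"
    unfolding K_def
  proof (intro continuous_on_diff)
    show "continuous_on ({0..1} \<times> {0..1}) (\<lambda>p. H (c (fst p) + \<rho> (fst p) * cis (2 * pi * snd p)))"
      by (rule continuous_on_compose2[OF cont])
        (use inside(2) in \<open>auto simp: c_def \<rho>_def intro!: continuous_intros\<close>)
    show "continuous_on ({0..1} \<times> {0..1}) (\<lambda>p. H (c (fst p)))"
      by (rule continuous_on_compose2[OF cont])
        (use inside(1) in \<open>auto simp: c_def intro!: continuous_intros\<close>)
  qed
  have K0: "K p \<noteq> 0" if "p \<in> {0..1} \<times> {0..1}" for p
  proof
    assume "K p = 0"
    then have "H (c (fst p) + \<rho> (fst p) * cis (2 * pi * snd p)) = H (c (fst p))"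
      by (simp add: K_def)
    then have "c (fst p) + \<rho> (fst p) * cis (2 * pi * snd p) = c (fst p)"
      by (rule inj_onD[OF inj _ inside(2) inside(1)]) (use that in auto)
    then have "\<rho> (fst p) = 0" by simp
    then show False using \<rho>_pos[of "fst p"] that by auto
  qed
  have "homotopic_loops (- {0}) (\<lambda>t. (H \<circ> circlepath z r) t - H z) (H \<circ> circlepath 0 1)"
    unfolding homotopic_loops
    by (rule exI[of _ K])
      (use contK K0 \<open>H 0 = 0\<close> in \<open>auto simp: K_def c_def \<rho>_def cp pathfinish_def pathstart_def\<close>)
  then show "winding_number (H \<circ> circlepath z r) (H z) = 1"
    using winding_number_homotopic_loops wn winding_number_offset[of "H \<circ> circlepath z r" "H z"]
    by metis
qed

lemma periodic_of_int:
  fixes P :: "complex \<Rightarrow> 'a"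
  assumes "\<And>w::complex. P (w + 2 * pi) = P w"
  shows "P ((w::complex) + 2 * pi * of_int n) = P w"
proof -
  have nat: "P (w + 2 * pi * of_nat n) = P w" for w :: complex and n
  proof (induction n)
    case (Suc n)
    have "w + 2 * pi * of_nat (Suc n) = (w + 2 * pi * of_nat n) + 2 * pi"
      by (simp add: algebra_simps)
    then show ?case unfolding assms[of "w + 2 * pi * of_nat n"] Suc[symmetric] by (rule ssubst) (rule assms)
  qed simp
  show ?thesis
  proof (cases n rule: int_cases2)
    case (nonneg m) then show ?thesis using nat[of w m] by simp
  next
    case (nonpos m)
    then show ?thesis using nat[of "w - 2 * pi * of_nat m" m] by simp
  qed
qed

text \<open>
  A function of period \<open>2 * pi\<close> gives a function of \<open>exp (\<i> * w)\<close> which may be computed with any branch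
  of the logarithm. The next two lemmas use this to cross the branch cut of \<open>Ln\<close>: near \<open>z\<close> the branch
  \<open>Ln (\<zeta> / z) + Ln z\<close> is used instead.
\<close>

lemma periodic_log:
  fixes P :: "complex \<Rightarrow> 'a"
  assumes "\<And>w::complex. P (w + 2 * pi) = P w"
  shows "P (- \<i> * Ln (exp (\<i> * w))) = P w"
proof -
  have "exp (Ln (exp (\<i> * w))) = exp (\<i> * w)" by (simp add: exp_Ln)
  then obtain n :: int where "Ln (exp (\<i> * w)) = \<i> * w + of_int (2 * n) * pi * \<i>"
    unfolding exp_eq by auto
  then have "- \<i> * Ln (exp (\<i> * w)) = w + 2 * pi * of_int n"
    by (simp add: algebra_simps)
  then show ?thesis using periodic_of_int[of P, OF assms] by simp
qed

lemma continuous_log_coordinate: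
  assumes per: "\<And>w::complex. P (w + 2 * pi) = P w" and "z \<noteq> 0"
    and cont: "isCont P (- \<i> * Ln z)"
  shows "isCont (\<lambda>z. P (- \<i> * Ln z)) z"
proof -
  define L where "L \<zeta> = Ln (\<zeta> / z) + Ln z" for \<zeta>
  have "isCont L z" unfolding L_def
    using \<open>z \<noteq> 0\<close> by (intro continuous_intros) auto
  moreover have "L z = Ln z" using \<open>z \<noteq> 0\<close> by (simp add: L_def)
  ultimately have "isCont (\<lambda>\<zeta>. P (- \<i> * L \<zeta>)) z"
    using cont by (intro isCont_o2[of z "\<lambda>\<zeta>. - \<i> * L \<zeta>" P] continuous_intros) auto
  moreover have "\<forall>\<^sub>F \<zeta> in nhds z. P (- \<i> * L \<zeta>) = P (- \<i> * Ln \<zeta>)"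
    using t1_space_nhds[OF \<open>z \<noteq> 0\<close>]
  proof eventually_elim
    case (elim \<zeta>)
    then show ?case
      using periodic_log[of P "- \<i> * L \<zeta>", OF per] \<open>z \<noteq> 0\<close>
      by (simp add: L_def exp_add exp_Ln)
  qed
  from isCont_cong[OF this] calculation show ?thesis by simp
qed

lemma has_derivative_log_coordinate:
  fixes P :: "complex \<Rightarrow> complex"
  assumes per: "\<And>w::complex. P (w + 2 * pi) = P w" and "z \<noteq> 0"
    and der: "(P has_derivative P') (at (- \<i> * Ln z))"
  shows "((\<lambda>z. P (- \<i> * Ln z)) has_derivative (\<lambda>\<zeta>. P' (- \<i> * \<zeta> / z))) (at z)"
proof -
  define L where "L \<zeta> = Ln (\<zeta> / z) + Ln z" for \<zeta>
  have "(L has_field_derivative 1 / z) (at z)"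
    unfolding L_def using \<open>z \<noteq> 0\<close>
    by (auto intro!: derivative_eq_intros simp: field_simps)
  then have "((\<lambda>\<zeta>. - \<i> * L \<zeta>) has_derivative (\<lambda>\<zeta>. - \<i> * (1 / z * \<zeta>))) (at z)"
    unfolding has_field_derivative_def by (rule has_derivative_mult_right)
  moreover have "L z = Ln z" using \<open>z \<noteq> 0\<close> by (simp add: L_def)
  ultimately have "((\<lambda>\<zeta>. P (- \<i> * L \<zeta>)) has_derivative (\<lambda>\<zeta>. P' (- \<i> * (1 / z * \<zeta>)))) (at z)"
    using has_derivative_compose[of "\<lambda>\<zeta>. - \<i> * L \<zeta>" _ z UNIV P P'] der by simp
  then have "((\<lambda>\<zeta>. P (- \<i> * Ln \<zeta>)) has_derivative (\<lambda>\<zeta>. P' (- \<i> * (1 / z * \<zeta>)))) (at z)"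
  proof (rule has_derivative_transform_within_open)
    show "open (- {0::complex})" "z \<in> - {0}" using \<open>z \<noteq> 0\<close> by auto
    show "P (- \<i> * L \<zeta>) = P (- \<i> * Ln \<zeta>)" if "\<zeta> \<in> - {0}" for \<zeta>
    using periodic_log[of P "- \<i> * L \<zeta>", OF per] that \<open>z \<noteq> 0\<close>
    by (simp add: L_def exp_add exp_Ln)
  qed
  then show ?thesis by simp
qed

context circle_lift
begin

definition strip_ext :: "complex \<Rightarrow> complex" where
  "strip_ext w = (if Im w \<le> 2 * pi then BA w else w + of_real shift)"

definition disk_ext :: "complex \<Rightarrow> complex" where
  "disk_ext z = (if z = 0 then 0 else exp (\<i> * strip_ext (- \<i> * Ln z)))"

lemma strip_ext_above: "2 * pi \<le> Im w \<Longrightarrow> strip_ext w = w + of_real shift"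
  by (auto simp: strip_ext_def BA_top)

lemma cont_strip_ext: "continuous_on UNIV strip_ext"
proof -
  have "continuous_on ({w. Im w \<le> 2 * pi} \<union> {w. 2 * pi \<le> Im w}) strip_ext"
    unfolding strip_ext_def
    by (rule continuous_on_cases)
      (auto intro!: continuous_intros closed_Collect_le BA_top
        continuous_on_subset[OF cont_BA])
  moreover have "{w. Im w \<le> 2 * pi} \<union> {w. 2 * pi \<le> Im w} = UNIV" by auto
  ultimately show ?thesis by simp
qed

lemma strip_ext_period: "strip_ext ((w::complex) + 2 * pi) = strip_ext w + 2 * pi"
  using BA_period[of w] by (simp add: strip_ext_def)

lemma strip_ext_period_int: "strip_ext ((w::complex) + 2 * pi * of_int n) = strip_ext w + 2 * pi * of_int n"
proof -
  have "strip_ext (w + 2 * pi * of_int n) - (w + 2 * pi * of_int n) = strip_ext w - w"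
    by (rule periodic_of_int[of "\<lambda>w. strip_ext w - w"]) (simp only: strip_ext_period, simp)
  then show ?thesis by (simp add: algebra_simps)
qed

lemma exp_strip_ext_period: "exp (\<i> * strip_ext ((w::complex) + 2 * pi)) = exp (\<i> * strip_ext w)"
proof -
  have "exp (\<i> * (2 * pi)) = 1"
    using exp_two_pi_i by (simp add: mult_ac)
  then show ?thesis
    by (simp only: strip_ext_period distrib_left exp_add)
      (simp add: distrib_left exp_add)
qed

lemma Im_strip_ext_pos: "0 < Im w \<Longrightarrow> 0 < Im (strip_ext w)"
  by (simp add: strip_ext_def Im_BA_pos)

lemma strip_ext_real: "strip_ext (of_real x) = of_real (f x)"
  by (simp add: strip_ext_def BA_real)

lemma inj_on_strip_ext: "inj_on strip_ext {w. 0 \<le> Im w}"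
proof (rule inj_onI)
  fix w z assume wz: "w \<in> {w. 0 \<le> Im w}" "z \<in> {w. 0 \<le> Im w}" and eq: "strip_ext w = strip_ext z"
  have less: "Im (strip_ext u) < 2 * pi \<longleftrightarrow> Im u < 2 * pi" for u
    using Im_BA_less[of u] strip_ext_above[of u] by (cases "Im u < 2 * pi") (auto simp: strip_ext_def)
  show "w = z"
  proof (cases "Im w < 2 * pi")
    case True
    then have "Im z < 2 * pi" using less eq by metis
    with True eq have "BA w = BA z" by (simp add: strip_ext_def)
    then show ?thesis using inj_onD[OF inj_on_BA] wz by blast
  next
    case False
    then have "\<not> Im z < 2 * pi" using less eq by metis
    with False eq show ?thesis by (simp add: strip_ext_above)
  qed
qed

lemma disk_ext_exp: "disk_ext (exp (\<i> * w)) = exp (\<i> * strip_ext w)"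
  unfolding disk_ext_def
  using periodic_log[of "\<lambda>w. exp (\<i> * strip_ext w)", OF exp_strip_ext_period] by simp

lemma disk_ext_cis: "disk_ext (cis x) = cis (f x)"
  using disk_ext_exp[of "of_real x"] by (simp add: strip_ext_real cis_conv_exp)

text \<open>
  The map \<open>w \<mapsto> exp (\<i> * w)\<close> takes the line \<open>Im w = 2 * pi\<close> to the circle of this radius.
\<close>

definition core_radius :: real where
  "core_radius = exp (- 2 * pi)"

lemma disk_ext_core:
  assumes "norm z \<le> core_radius"
  shows "disk_ext z = cis shift * z"
proof (cases "z = 0")
  case False
  have "ln (norm z) \<le> - 2 * pi"
    using assms False unfolding core_radius_def by (metis ln_exp ln_mono zero_less_norm_iff)
  then have "strip_ext (- \<i> * Ln z) = - \<i> * Ln z + of_real shift"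
    using False by (intro strip_ext_above) simp
  moreover have "\<i> * (- \<i> * Ln z + of_real shift) = \<i> * of_real shift + Ln z"
    by (simp add: algebra_simps)
  ultimately show ?thesis
    using False by (simp add: disk_ext_def exp_add cis_conv_exp exp_Ln)
qed (simp add: disk_ext_def)

lemma core_radius: "0 < core_radius" "core_radius < 1"
  by (auto simp: core_radius_def)

lemma isCont_disk_ext: "isCont disk_ext z"
proof (cases "z = 0")
  case True
  have "isCont (\<lambda>z. cis shift * z) 0" by (intro continuous_intros)
  moreover have "\<forall>\<^sub>F z in nhds 0. cis shift * z = disk_ext z"
    using eventually_nhds_in_open[of "ball 0 core_radius" 0] core_radius(1)
    by (auto simp: disk_ext_core elim!: eventually_mono)
  from isCont_cong[OF this] calculation show ?thesis using True by simp
next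
  case False
  have "isCont (\<lambda>w. exp (\<i> * strip_ext w)) w" for w
    using cont_strip_ext by (intro continuous_intros) (auto simp: continuous_on_eq_continuous_at)
  then have "isCont (\<lambda>z. exp (\<i> * strip_ext (- \<i> * Ln z))) z"
    by (intro continuous_log_coordinate[of "\<lambda>w. exp (\<i> * strip_ext w)"] False exp_strip_ext_period)
  moreover have "\<forall>\<^sub>F z in nhds z. exp (\<i> * strip_ext (- \<i> * Ln z)) = disk_ext z"
    using t1_space_nhds[OF False] by (auto simp: disk_ext_def elim!: eventually_mono)
  from isCont_cong[OF this] calculation show ?thesis by simp
qed

lemma cont_disk_ext: "continuous_on S disk_ext"
  using isCont_disk_ext by (simp add: continuous_at_imp_continuous_on)

text \<open>
  Equal values in the disk come from values of \<open>strip_ext\<close> that differ by a multiple of \<open>2 * pi\<close>;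
  periodicity moves this multiple to the argument, where injectivity of \<open>strip_ext\<close> applies.
\<close>

lemma inj_on_disk_ext: "inj_on disk_ext (cball 0 1)"
proof (rule inj_onI)
  fix z z' :: complex
  assume z: "z \<in> cball 0 1" "z' \<in> cball 0 1" and eq: "disk_ext z = disk_ext z'"
  show "z = z'"
  proof (cases "z = 0 \<or> z' = 0")
    case True
    then show ?thesis using eq by (auto simp: disk_ext_def split: if_splits)
  next
    case False
    define w w' where "w = - \<i> * Ln z" and "w' = - \<i> * Ln z'"
    have Im: "0 \<le> Im w" "0 \<le> Im w'"
      using z False by (auto simp: w_def w'_def)
    have zw: "z = exp (\<i> * w)" "z' = exp (\<i> * w')"
      using False by (auto simp: w_def w'_def exp_Ln)
    have "exp (\<i> * strip_ext w) = exp (\<i> * strip_ext w')"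
      using eq by (simp add: zw disk_ext_exp)
    then obtain n :: int where "\<i> * strip_ext w = \<i> * strip_ext w' + of_int (2 * n) * pi * \<i>"
      unfolding exp_eq by auto
    then have "strip_ext w = strip_ext w' + 2 * pi * of_int n"
      by (simp add: complex_eq_iff)
    then have "strip_ext w = strip_ext (w' + 2 * pi * of_int n)"
      using strip_ext_period_int[of w' n] by simp
    then have "w = w' + 2 * pi * of_int n"
      using inj_onD[OF inj_on_strip_ext, of w "w' + 2 * pi * of_int n"] Im by simp
    then have "\<i> * w = \<i> * w' + of_int (2 * n) * pi * \<i>"
      by (simp add: algebra_simps)
    then have "exp (\<i> * w) = exp (\<i> * w')"
      unfolding exp_eq by blast
    then show ?thesis by (simp add: zw)
  qed
qed

lemma disk_ext_ball: "disk_ext ` ball 0 1 \<subseteq> ball 0 1"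
proof safe
  fix z :: complex assume z: "z \<in> ball 0 1"
  show "disk_ext z \<in> ball 0 1"
  proof (cases "z = 0")
    case False
    then have "0 < Im (- \<i> * Ln z)" using z by simp
    from Im_strip_ext_pos[OF this] show ?thesis using False by (simp add: disk_ext_def)
  qed (simp add: disk_ext_def)
qed

end

section \<open>Weak differentials of piecewise smooth maps\<close>

text \<open>
  The link between the plane and iterated integrals: both measures agree on boxes.
\<close>

lemma lborel_complex_eq_distr:
  "lborel = distr (lborel \<Otimes>\<^sub>M lborel) borel (\<lambda>p. Complex (fst p) (snd p))"
proof (rule lborel_eqI)
  have meas: "(\<lambda>p. Complex (fst p) (snd p)) \<in> borel_measurable (lborel \<Otimes>\<^sub>M lborel)"
    unfolding Complex_eq by measurable
  fix l u :: complex assume *: "\<And>b. b \<in> Basis \<Longrightarrow> l \<bullet> b \<le> u \<bullet> b"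
  then have le: "Re l \<le> Re u" "Im l \<le> Im u"
    using *[of 1] *[of \<i>] by (auto simp: Basis_complex_def)
  have "emeasure (distr (lborel \<Otimes>\<^sub>M lborel) borel (\<lambda>p. Complex (fst p) (snd p))) (box l u) =
      emeasure (lborel \<Otimes>\<^sub>M lborel) ((\<lambda>p. Complex (fst p) (snd p)) -` box l u \<inter> space (lborel \<Otimes>\<^sub>M lborel))"
    by (rule emeasure_distr[OF meas]) simp
  also have "(\<lambda>p. Complex (fst p) (snd p)) -` box l u \<inter> space (lborel \<Otimes>\<^sub>M lborel) =
      {Re l<..<Re u} \<times> {Im l<..<Im u}"
    by (auto simp: space_pair_measure in_box_complex_iff)
  also have "emeasure (lborel \<Otimes>\<^sub>M lborel) \<dots> = ennreal ((Re u - Re l) * (Im u - Im l))"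
    using le by (simp add: lborel.emeasure_pair_measure_Times ennreal_mult)
  also have "(Re u - Re l) * (Im u - Im l) = (\<Prod>b\<in>Basis. (u - l) \<bullet> b)"
    by (simp add: Basis_complex_def complex_eq_iff)
  finally show "emeasure (distr (lborel \<Otimes>\<^sub>M lborel) borel (\<lambda>p. Complex (fst p) (snd p))) (box l u) =
      ennreal (\<Prod>b\<in>Basis. (u - l) \<bullet> b)" .
qed simp

lemma measurable_Complex[measurable]:
  "(\<lambda>p. Complex (fst p) (snd p)) \<in> borel_measurable (lborel \<Otimes>\<^sub>M lborel)"
  unfolding Complex_eq by measurable

text \<open>
  By Fubini's theorem the integral is an iterated one whose inner integrals run over lines parallel
  to \<open>v\<close>. On a line where \<open>d\<close> is Lebesgue integrable its integral is the Henstock--Kurzweil one; on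
  the others it is \<open>0\<close> by convention.
\<close>

lemma integral_complex_eq_0:
  fixes d :: "complex \<Rightarrow> complex"
  assumes int: "integrable lborel d"
    and v: "v \<in> Basis"
    and lines: "\<And>c. ((\<lambda>t::real. d (c + t *\<^sub>R v)) has_integral 0) UNIV"
  shows "integral\<^sup>L lborel d = 0"
proof -
  have inner: "(LINT t|lborel. d (c + t *\<^sub>R v)) = 0" for c
    by (metis lines has_integral_integral_lborel has_integral_unique not_integrable_integral_eq)
  have [measurable]: "d \<in> borel_measurable borel"
    using borel_measurable_integrable[OF int] by simp
  have int2: "integrable (lborel \<Otimes>\<^sub>M lborel) (\<lambda>p. d (Complex (fst p) (snd p)))"
    using int by (subst (asm) lborel_complex_eq_distr) (simp add: integrable_distr_eq)
  then have int3: "integrable (lborel \<Otimes>\<^sub>M lborel) (case_prod (\<lambda>x y. d (Complex x y)))"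
    by (simp add: case_prod_unfold)
  have eq: "integral\<^sup>L lborel d = (LINT p|(lborel \<Otimes>\<^sub>M lborel). d (Complex (fst p) (snd p)))"
    by (subst lborel_complex_eq_distr) (simp add: integral_distr)
  have "v = 1 \<or> v = \<i>" using v by (auto simp: Basis_complex_def)
  then show ?thesis
  proof
    assume "v = 1"
    have "(LINT x|lborel. d (Complex x y)) = 0" for y
      using inner[of "Complex 0 y"] \<open>v = 1\<close> by (simp add: Complex_eq add.commute scaleR_conv_of_real)
    then show ?thesis
      using lborel_pair.integral_snd[OF int3] by (simp add: eq case_prod_unfold)
  next
    assume "v = \<i>"
    have "(LINT y|lborel. d (Complex x y)) = 0" for x
      using inner[of "Complex x 0"] \<open>v = \<i>\<close> by (simp add: Complex_eq scaleR_conv_of_real mult.commute)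
    then show ?thesis
      using lborel_pair.integral_fst[OF int3] by (simp add: eq case_prod_unfold)
  qed
qed

text \<open>
  A map that is continuous, and differentiable off a set that meets every line parallel to an axis in
  finitely many points, has its pointwise derivative as a weak differential as soon as this is locally
  integrable. The product with a test function, extended by \<open>0\<close>, is continuous with
  compact support, so by the fundamental theorem of calculus its derivative integrates to \<open>0\<close> along
  every such line, and then over the plane.
\<close>

lemma weak_differential_of_line_derivatives:
  assumes U: "open U" and contH: "continuous_on U H"
    and D: "\<And>z. z \<in> U - S \<Longrightarrow> (H has_derivative blinfun_apply (D z)) (at z)"
    and fin: "\<And>c v. v \<in> Basis \<Longrightarrow> finite {t::real. c + t *\<^sub>R v \<in> S}"
    and locint: "\<And>v. v \<in> Basis \<Longrightarrow> locally_integrable_on U (\<lambda>z. blinfun_apply (D z) v)"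
    and meas: "\<And>v. v \<in> Basis \<Longrightarrow> (\<lambda>z. indicator U z *\<^sub>R blinfun_apply (D z) v) \<in> borel_measurable borel"
  shows "weak_differential U H D"
  unfolding weak_differential_def
proof (intro ballI conjI allI impI)
  fix v :: complex and \<phi> assume v: "v \<in> Basis" and \<phi>: "test_function U \<phi>"
  define K where "K = closure {z. \<phi> z \<noteq> 0}"
  have K: "compact K" "K \<subseteq> U" and Ck: "\<And>k. Ck k \<phi>"
    using \<phi> by (auto simp: test_function_def K_def)
  have \<phi>0: "\<phi> z = 0" if "z \<notin> K" for z
    using that closure_subset[of "{z. \<phi> z \<noteq> 0}"] by (auto simp: K_def)
  have cont\<phi>: "continuous_on UNIV \<phi>" using Ck[of 0] by simp
  define \<phi>v where "\<phi>v z = frechet_derivative \<phi> (at z) v" for z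
  have cont\<phi>v: "continuous_on UNIV \<phi>v"
    using Ck[of 1] v by (simp add: \<phi>v_def)
  have diff\<phi>: "(\<phi> has_derivative frechet_derivative \<phi> (at z)) (at z)" for z
    using Ck[of 1] by (simp add: frechet_derivative_works[symmetric])
  have out: "open (- K)" using K(1) compact_imp_closed by blast
  have \<phi>v0: "\<phi>v z = 0" if "z \<notin> K" for z
  proof -
    have "(\<phi> has_derivative (\<lambda>_. 0)) (at z)"
      by (rule has_derivative_transform_within_open[OF has_derivative_const[of 0] out])
        (use that \<phi>0 in auto)
    then show ?thesis
      unfolding \<phi>v_def using frechet_derivative_at by metis
  qed
  \<comment> \<open>\<open>p + q\<close> is the derivative of \<open>\<phi> *\<^sub>R H\<close> in direction \<open>v\<close>\<close>
  define p where "p z = indicator U z *\<^sub>R (\<phi>v z *\<^sub>R H z)" for z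
  define q where "q z = \<phi> z *\<^sub>R (indicator U z *\<^sub>R blinfun_apply (D z) v)" for z
  have int_p: "integrable lborel p"
  proof -
    have "integrable lborel (\<lambda>z. indicator K z *\<^sub>R (\<phi>v z *\<^sub>R H z))"
      by (intro borel_integrable_compact K continuous_intros continuous_on_subset[OF contH]
          continuous_on_subset[OF cont\<phi>v]) auto
    moreover have "(\<lambda>z. indicator K z *\<^sub>R (\<phi>v z *\<^sub>R H z)) = p"
      using K(2) \<phi>v0 by (auto simp: p_def fun_eq_iff indicator_def)
    ultimately show ?thesis by simp
  qed
  have int_q: "integrable lborel q"
  proof -
    have [measurable]: "\<phi> \<in> borel_measurable borel"
      using cont\<phi> by (rule borel_measurable_continuous_onI)
    have q_meas: "q \<in> borel_measurable borel"
      unfolding q_def by (intro borel_measurable_scaleR meas v) measurable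
    obtain C where C: "\<And>z. z \<in> K \<Longrightarrow> norm (\<phi> z) \<le> C"
      using compact_imp_bounded[OF compact_continuous_image[OF continuous_on_subset[OF cont\<phi>] K(1)]]
      unfolding bounded_iff by auto
    have "integrable lebesgue (\<lambda>z. C *\<^sub>R (indicator K z *\<^sub>R blinfun_apply (D z) v))"
      using locint[OF v] K unfolding locally_integrable_on_def set_integrable_def
      by (intro integrable_scaleR_right) auto
    then have "integrable lebesgue q"
    proof (rule Bochner_Integration.integrable_bound)
      show "q \<in> borel_measurable lebesgue"
        using q_meas by (simp add: measurable_completion)
      have "norm (q z) \<le> norm (C *\<^sub>R (indicator K z *\<^sub>R blinfun_apply (D z) v))" for z
      proof (cases "z \<in> K")
        case True
        then have "\<bar>\<phi> z\<bar> \<le> \<bar>C\<bar>" using C[OF True] by simp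
        then show ?thesis using True K(2) by (auto simp: q_def intro!: mult_right_mono)
      qed (simp add: q_def \<phi>0)
      then show "AE z in lebesgue. norm (q z) \<le> norm (C *\<^sub>R (indicator K z *\<^sub>R blinfun_apply (D z) v))"
        by simp
    qed
    then show ?thesis
      using integrable_completion[of q lborel] q_meas by simp
  qed
  define \<psi> where "\<psi> z = (if z \<in> U then \<phi> z *\<^sub>R H z else 0)" for z
  have \<psi>0: "\<psi> z = 0" if "z \<notin> K" for z
    using \<phi>0[OF that] by (simp add: \<psi>_def)
  have cont_at: "isCont \<psi> z" for z
  proof (cases "z \<in> U")
    case True
    have "isCont (\<lambda>z. \<phi> z *\<^sub>R H z) z"
      using True U contH cont\<phi> by (intro continuous_intros) (auto simp: continuous_on_eq_continuous_at)
    moreover have "\<forall>\<^sub>F z in nhds z. \<phi> z *\<^sub>R H z = \<psi> z"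
      using eventually_nhds_in_open[OF U True] by (auto simp: \<psi>_def elim!: eventually_mono)
    from isCont_cong[OF this] calculation show ?thesis by simp
  next
    case False
    then have "z \<in> - K" using K(2) by auto
    then have "\<forall>\<^sub>F z in nhds z. 0 = \<psi> z"
      by (rule eventually_mono[OF eventually_nhds_in_open[OF out]]) (simp add: \<psi>0)
    from isCont_cong[OF this] show ?thesis by simp
  qed
  have der: "(\<psi> has_derivative (\<lambda>\<zeta>. indicator U z *\<^sub>R (frechet_derivative \<phi> (at z) \<zeta> *\<^sub>R H z)
      + \<phi> z *\<^sub>R (indicator U z *\<^sub>R blinfun_apply (D z) \<zeta>))) (at z)" if "z \<notin> S" for z
  proof (cases "z \<in> U")
    case True
    have "((\<lambda>z. \<phi> z *\<^sub>R H z) has_derivative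
        (\<lambda>\<zeta>. \<phi> z *\<^sub>R blinfun_apply (D z) \<zeta> + frechet_derivative \<phi> (at z) \<zeta> *\<^sub>R H z)) (at z)"
      by (rule has_derivative_scaleR[OF diff\<phi> D]) (use True that in auto)
    then have "(\<psi> has_derivative
        (\<lambda>\<zeta>. \<phi> z *\<^sub>R blinfun_apply (D z) \<zeta> + frechet_derivative \<phi> (at z) \<zeta> *\<^sub>R H z)) (at z)"
      by (rule has_derivative_transform_within_open[OF _ U True]) (simp add: \<psi>_def)
    then show ?thesis using True by (simp add: add.commute)
  next
    case False
    then have "(\<psi> has_derivative (\<lambda>_. 0)) (at z)"
      by (intro has_derivative_transform_within_open[OF has_derivative_const[of 0] out])
        (use K(2) \<psi>0 in auto)
    then show ?thesis using False by simp
  qed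
  obtain B where B: "\<And>z. z \<in> K \<Longrightarrow> norm z \<le> B" "0 < B"
    using compact_imp_bounded[OF K(1)] bounded_pos by metis
  have norm_v: "norm v = 1" using v by (rule norm_Basis)
  have "integral\<^sup>L lborel (\<lambda>z. p z + q z) = 0"
  proof (rule integral_complex_eq_0[OF _ v])
    show "integrable lborel (\<lambda>z. p z + q z)" using int_p int_q by simp
    fix c :: complex
    \<comment> \<open>the line through \<open>c\<close> leaves \<open>K\<close> outside the parameters in \<open>{-R<..<R}\<close>\<close>
    define R where "R = B + norm c + 1"
    have far: "c + t *\<^sub>R v \<notin> K" if "\<bar>t\<bar> \<ge> R" for t
    proof
      assume "c + t *\<^sub>R v \<in> K"
      then have "norm (c + t *\<^sub>R v) \<le> B" by (rule B)
      moreover have "\<bar>t\<bar> \<le> norm (c + t *\<^sub>R v) + norm c"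
        using norm_triangle_ineq4[of "c + t *\<^sub>R v" c] norm_v by simp
      ultimately show False using that by (simp add: R_def)
    qed
    have "0 < R" using B(2) by (simp add: R_def add_pos_nonneg)
    have "((\<lambda>t. p (c + t *\<^sub>R v) + q (c + t *\<^sub>R v)) has_integral
        \<psi> (c + R *\<^sub>R v) - \<psi> (c + (-R) *\<^sub>R v)) {-R..R}"
    proof (rule fundamental_theorem_of_calculus_interior_strong[OF fin[OF v, of c]])
      show "-R \<le> R" using \<open>0 < R\<close> by simp
      show "continuous_on {-R..R} (\<lambda>t. \<psi> (c + t *\<^sub>R v))"
        by (intro continuous_at_imp_continuous_on ballI isCont_o2[OF _ cont_at] continuous_intros)
      fix t assume t: "t \<in> {-R<..<R} - {t. c + t *\<^sub>R v \<in> S}"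
      have "((\<lambda>t. c + t *\<^sub>R v) has_derivative (\<lambda>h. h *\<^sub>R v)) (at t)"
        by (auto intro!: derivative_eq_intros)
      from has_derivative_compose[OF this der] t
      have "((\<lambda>t. \<psi> (c + t *\<^sub>R v)) has_derivative
          (\<lambda>h. indicator U (c + t *\<^sub>R v) *\<^sub>R (frechet_derivative \<phi> (at (c + t *\<^sub>R v)) (h *\<^sub>R v) *\<^sub>R H (c + t *\<^sub>R v))
      + \<phi> (c + t *\<^sub>R v) *\<^sub>R (indicator U (c + t *\<^sub>R v) *\<^sub>R blinfun_apply (D (c + t *\<^sub>R v)) (h *\<^sub>R v)))) (at t)"
        by simp
      then show "((\<lambda>t. \<psi> (c + t *\<^sub>R v)) has_vector_derivative p (c + t *\<^sub>R v) + q (c + t *\<^sub>R v)) (at t)"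
        unfolding has_vector_derivative_def
        by (rule has_derivative_eq_rhs)
          (auto simp: p_def q_def \<phi>v_def fun_eq_iff blinfun.scaleR_right scaleR_add_right
            linear_scale[OF has_derivative_linear[OF diff\<phi>]] mult_ac)
    qed
    then have "((\<lambda>t. p (c + t *\<^sub>R v) + q (c + t *\<^sub>R v)) has_integral 0) {-R..R}"
      using far[of R] far[of "-R"] \<open>0 < R\<close> by (simp add: \<psi>0)
    then show "((\<lambda>t. p (c + t *\<^sub>R v) + q (c + t *\<^sub>R v)) has_integral 0) UNIV"
      by (rule has_integral_on_superset) (use far \<phi>0 \<phi>v0 in \<open>auto simp: p_def q_def\<close>)
  qed
  then have "integral\<^sup>L lborel p = - integral\<^sup>L lborel q"
    using int_p int_q by (simp add: eq_neg_iff_add_eq_0)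
  moreover have "integral\<^sup>L lborel p = (LINT z:U|lebesgue. frechet_derivative \<phi> (at z) v *\<^sub>R H z)"
    using integral_completion[of p lborel] int_p
    by (simp add: set_lebesgue_integral_def p_def[abs_def] \<phi>v_def)
  moreover have "integral\<^sup>L lborel q = (LINT z:U|lebesgue. \<phi> z *\<^sub>R blinfun_apply (D z) v)"
    using integral_completion[of q lborel] int_q
    by (simp add: set_lebesgue_integral_def q_def[abs_def] mult.commute)
  ultimately show "(LINT z:U|lebesgue. frechet_derivative \<phi> (at z) v *\<^sub>R H z) =
      - (LINT z:U|lebesgue. \<phi> z *\<^sub>R blinfun_apply (D z) v)"
    by simp
qed (rule locint)

lemma finite_line_Int_sphere:
  fixes c v :: complex
  assumes "v \<in> Basis"
  shows "finite {t::real. c + t *\<^sub>R v \<in> sphere 0 r}"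
proof -
  have "(t + c \<bullet> v)\<^sup>2 = r\<^sup>2 - (norm c)\<^sup>2 + (c \<bullet> v)\<^sup>2" if "c + t *\<^sub>R v \<in> sphere 0 r" for t
  proof -
    have "r\<^sup>2 = (norm (c + t *\<^sub>R v))\<^sup>2" using that by simp
    also have "\<dots> = c \<bullet> c + 2 * t * (c \<bullet> v) + t\<^sup>2 * (v \<bullet> v)"
      unfolding power2_norm_eq_inner
      by (simp add: inner_add_left inner_add_right inner_commute power2_eq_square algebra_simps
          del: inner_complex_def)
    also have "\<dots> = (norm c)\<^sup>2 + 2 * t * (c \<bullet> v) + t\<^sup>2"
      unfolding power2_norm_eq_inner by (simp only: inner_same_Basis[OF assms] mult_1_right)
    finally show ?thesis by (simp add: power2_eq_square algebra_simps)
  qed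
  then have "{t. c + t *\<^sub>R v \<in> sphere 0 r} \<subseteq>
      {- (c \<bullet> v) + sqrt (r\<^sup>2 - (norm c)\<^sup>2 + (c \<bullet> v)\<^sup>2), - (c \<bullet> v) - sqrt (r\<^sup>2 - (norm c)\<^sup>2 + (c \<bullet> v)\<^sup>2)}"
    by (smt (verit) insertCI mem_Collect_eq real_sqrt_abs subsetI)
  then show ?thesis by (rule finite_subset) simp
qed

section \<open>The dilatation of the Beurling--Ahlfors extension\<close>

lemma line_mean_split:
  assumes "continuous_on UNIV f"
  shows "(b - a) * line_mean f a b = (c - a) * line_mean f a c + (b - c) * line_mean f c b"
proof -
  obtain \<Phi> where \<Phi>: "\<And>x. (\<Phi> has_real_derivative f x) (at x)"
    using continuous_imp_antiderivative[OF assms] by blast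
  show ?thesis
    by (simp add: line_mean_antiderivative[of \<Phi> f, OF \<Phi>])
qed

lemma line_mean_bounds:
  assumes "continuous_on UNIV f" "strict_mono f" "a \<le> b"
  shows "f a \<le> line_mean f a b" "line_mean f a b \<le> f b"
  using line_mean_strict_mono[OF assms(1,2), of a a a b] line_mean_strict_mono[OF assms(1,2), of a b b b] assms(3)
  by (cases "a = b"; simp)+

text \<open>
  Reflecting \<open>f\<close> exchanges the roles of the two sides of a point; this lets the estimates be proved
  for a dominating right increment only.
\<close>

lemma line_mean_reflect:
  assumes "continuous_on UNIV f" "a < b"
  shows "line_mean (\<lambda>x. - f (- x)) (- b) (- a) = - line_mean f a b"
proof -
  obtain \<Phi> where \<Phi>: "\<And>x. (\<Phi> has_real_derivative f x) (at x)"
    using continuous_imp_antiderivative[OF assms(1)] by blast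
  have "((\<lambda>x. \<Phi> (- x)) has_real_derivative - f (- x)) (at x)" for x
    using DERIV_chain2[OF \<Phi> DERIV_minus[OF DERIV_ident]] by simp
  from line_mean_antiderivative[of "\<lambda>x. \<Phi> (- x)", OF this, of "- a" "- b"]
  have "(b - a) * line_mean (\<lambda>x. - f (- x)) (- b) (- a) = (b - a) * (- line_mean f a b)"
    using line_mean_antiderivative[of \<Phi> f, OF \<Phi>, of b a] by (simp add: algebra_simps)
  then show ?thesis using assms(2) by (subst (asm) mult_cancel_left) simp
qed

text \<open>
  The estimate on which everything rests. The increment \<open>A\<close> to the right dominates, and half of it is
  taken either on the right or on the left half of \<open>{x..x + y}\<close>.
  In the first case the mean over \<open>{x..x + y}\<close> stays well below \<open>f (x + y)\<close>, that is \<open>A' \<ge> A / 4\<close>, and only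
  \<open>A / B\<close> remains. In the second case consider the interval of radius \<open>(1/2 + s) * y\<close> about
  \<open>x - s * y\<close>: its right half ends at \<open>x + y / 2\<close> and so carries at least \<open>A / 2\<close>, while its left
  half lies in \<open>{x - y..x}\<close> and carries at most \<open>8 * B'\<close>.
\<close>

lemma one_sided_dilatation_bound:
  fixes f :: "real \<Rightarrow> real" and x y :: real
  assumes cont: "continuous_on UNIV f" and mono: "strict_mono f" and y: "0 < y"
  defines "A \<equiv> f (x + y) - f x" and "B \<equiv> f x - f (x - y)"
    and "A' \<equiv> f (x + y) - line_mean f x (x + y)" and "B' \<equiv> line_mean f (x - y) x - f (x - y)"
  assumes BA: "B \<le> A"
  shows "A\<^sup>2 / (A * B' + A' * B) \<le> 4 * (A / B) \<or>
    (\<forall>s\<in>{1/8..1/4}. A\<^sup>2 / (A * B' + A' * B) \<le>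
      16 * ((f (x - s * y + (1/2 + s) * y) - f (x - s * y)) / (f (x - s * y) - f (x - s * y - (1/2 + s) * y))))"
proof -
  have pos: "0 < A" "0 < B"
    using strict_monoD[OF mono] y by (auto simp: A_def B_def)
  have pos': "0 < A'" "0 < B'"
    using line_mean_strict_mono[OF cont mono, of x "x + y" "x + y" "x + y"]
      line_mean_strict_mono[OF cont mono, of "x - y" "x - y" "x - y" x] y
    by (auto simp: A'_def B'_def)
  have le: "f u \<le> f v" if "u \<le> v" for u v
    using strict_mono_mono[OF mono] that by (rule monoD)
  show ?thesis
  proof (cases "A / 2 \<le> f (x + y) - f (x + y/2)")
    case True
    have "y * line_mean f x (x + y) = (y/2) * line_mean f x (x + y/2) + (y/2) * line_mean f (x + y/2) (x + y)"
      using line_mean_split[OF cont, of "x + y" x "x + y/2"] by simp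
    also have "\<dots> \<le> (y/2) * f (x + y/2) + (y/2) * f (x + y)"
      using y by (intro add_mono mult_left_mono line_mean_bounds[OF cont mono]) auto
    also have "\<dots> = y * ((f (x + y/2) + f (x + y)) / 2)"
      by (simp add: field_simps)
    finally have "line_mean f x (x + y) \<le> (f (x + y/2) + f (x + y)) / 2"
      using y by simp
    then have "A / 4 \<le> A'" using True by (simp add: A'_def)
    then have "A / 4 * B \<le> A' * B" using pos by (intro mult_right_mono) auto
    also have "\<dots> \<le> A * B' + A' * B" using pos pos' by simp
    finally have "A\<^sup>2 / (A * B' + A' * B) \<le> A\<^sup>2 / (A / 4 * B)"
      using pos by (intro divide_left_mono mult_pos_pos) (auto intro: add_pos_pos simp: pos')
    also have "\<dots> = 4 * (A / B)"
      using pos by (simp add: power2_eq_square)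
    finally show ?thesis by simp
  next
    case False
    then have A2: "A \<le> 2 * (f (x + y/2) - f x)" by (simp add: A_def)
    have "A\<^sup>2 / (A * B' + A' * B) \<le>
      16 * ((f (x - s * y + (1/2 + s) * y) - f (x - s * y)) / (f (x - s * y) - f (x - s * y - (1/2 + s) * y)))"
      (is "_ \<le> 16 * (?R / ?L)") if s: "s \<in> {1/8..1/4}" for s
    proof -
      have sy: "0 < s * y" "s * y \<le> y / 4" using s y by (auto simp: mult_mono)
      have L: "0 < ?L" using strict_monoD[OF mono] s y by simp
      have "A \<le> 2 * ?R"
        using A2 le[of "x - s * y" x] sy by (simp add: algebra_simps)
      have "(1 - s) * y * f (x - y) + s * y * f (x - s * y) \<le>
          (1 - s) * y * line_mean f (x - y) (x - s * y) + s * y * line_mean f (x - s * y) x"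
        using y s sy by (intro add_mono mult_left_mono line_mean_bounds[OF cont mono]) auto
      also have "\<dots> = y * line_mean f (x - y) x"
        using line_mean_split[OF cont, of x "x - y" "x - s * y"] by (simp add: algebra_simps)
      finally have "y * (s * (f (x - s * y) - f (x - y))) \<le> y * B'"
        by (simp add: B'_def algebra_simps)
      then have "s * (f (x - s * y) - f (x - y)) \<le> B'"
        using y by simp
      moreover have "1/8 * ?L \<le> s * (f (x - s * y) - f (x - y))"
        using s L sy y by (intro mult_mono diff_left_mono le) (auto simp: algebra_simps)
      ultimately have B'_ge: "?L / 8 \<le> B'" by simp
      have "A\<^sup>2 / (A * B' + A' * B) \<le> A\<^sup>2 / (A * B')"
        using pos pos' by (intro divide_left_mono mult_pos_pos) (auto intro: add_pos_pos)
      also have "\<dots> = A / B'" using pos by (simp add: power2_eq_square)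
      also have "\<dots> \<le> 2 * ?R / (?L / 8)"
        using pos pos' \<open>A \<le> 2 * ?R\<close> B'_ge L by (intro frac_le) auto
      finally show ?thesis by simp
    qed
    then show ?thesis by blast
  qed
qed

context circle_lift
begin

definition jac_BA :: "complex \<Rightarrow> real" where
  "jac_BA w = right_incr w * left_gap w + right_gap w * left_incr w"

text \<open>
  An upper bound for the quasiconformal dilatation of \<open>BA\<close>, as \<open>norm_dBA\<close> and \<open>jac_dBA\<close> show; it is
  not the exact dilatation.
\<close>

definition dilatation_BA :: "complex \<Rightarrow> real" where
  "dilatation_BA w = 10 * (max (right_incr w) (left_incr w))\<^sup>2 / jac_BA w"

definition sym_distortion :: "real \<Rightarrow> real \<Rightarrow> real" where
  "sym_distortion x t = max ((f (x + t) - f x) / (f x - f (x - t))) ((f x - f (x - t)) / (f (x + t) - f x))"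

lemma jac_BA_pos: "0 < Im w \<Longrightarrow> 0 < jac_BA w"
  using incr_gap_pos[of w] unfolding jac_BA_def by (intro add_pos_pos mult_pos_pos)

lemma jac_dBA:
  assumes "0 < Im w"
  shows "Re (dBA w 1) * Im (dBA w \<i>) - Re (dBA w \<i>) * Im (dBA w 1) = jac_BA w / (Im w)\<^sup>2"
  using assms by (simp add: dBA_def dright_def dleft_def jac_BA_def field_simps power2_eq_square)

lemma norm_dBA:
  assumes w: "0 < Im w"
  shows "(norm (dBA w \<zeta>))\<^sup>2 \<le> dilatation_BA w * (jac_BA w / (Im w)\<^sup>2) * (norm \<zeta>)\<^sup>2"
proof -
  define m where "m = max (right_incr w) (left_incr w)"
  have m: "0 \<le> m" using incr_gap_pos[OF w] by (auto simp: m_def)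
  have CS: "(p * u + q * v)\<^sup>2 \<le> (p\<^sup>2 + q\<^sup>2) * (2 * m\<^sup>2)"
    if "\<bar>u\<bar> \<le> m" "\<bar>v\<bar> \<le> m" for p q u v :: real
  proof -
    have "(p * u + q * v)\<^sup>2 + (p * v - q * u)\<^sup>2 = (p\<^sup>2 + q\<^sup>2) * (u\<^sup>2 + v\<^sup>2)"
      by (simp add: power2_eq_square algebra_simps)
    then have "(p * u + q * v)\<^sup>2 \<le> (p\<^sup>2 + q\<^sup>2) * (u\<^sup>2 + v\<^sup>2)"
      using zero_le_power2[of "p * v - q * u"] by linarith
    also have "u\<^sup>2 \<le> m\<^sup>2" "v\<^sup>2 \<le> m\<^sup>2"
      using that m by (auto simp: abs_le_square_iff[symmetric])
    then have "(p\<^sup>2 + q\<^sup>2) * (u\<^sup>2 + v\<^sup>2) \<le> (p\<^sup>2 + q\<^sup>2) * (2 * m\<^sup>2)"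
      by (intro mult_left_mono) auto
    finally show ?thesis .
  qed
  have r: "(dright w \<zeta>)\<^sup>2 \<le> (norm \<zeta>)\<^sup>2 * (2 * m\<^sup>2) / (Im w)\<^sup>2"
    using CS[of "right_incr w" "right_gap w" "Re \<zeta>" "Im \<zeta>"] incr_gap_pos[OF w] gap_less_incr[OF w]
    unfolding dright_def power_divide cmod_power2 by (intro divide_right_mono) (auto simp: m_def)
  have l: "(dleft w \<zeta>)\<^sup>2 \<le> (norm \<zeta>)\<^sup>2 * (2 * m\<^sup>2) / (Im w)\<^sup>2"
    using CS[of "left_incr w" "- left_gap w" "Re \<zeta>" "Im \<zeta>"] incr_gap_pos[OF w] gap_less_incr[OF w]
    unfolding dleft_def power_divide cmod_power2 by (intro divide_right_mono) (auto simp: m_def)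
  have "(norm (dBA w \<zeta>))\<^sup>2 = ((dright w \<zeta> + dleft w \<zeta>) / 2)\<^sup>2 + (dright w \<zeta> - dleft w \<zeta>)\<^sup>2"
    by (simp add: dBA_def cmod_power2)
  also have "\<dots> \<le> 5/2 * ((dright w \<zeta>)\<^sup>2 + (dleft w \<zeta>)\<^sup>2)"
    using zero_le_power2[of "dright w \<zeta> + dleft w \<zeta>"] zero_le_power2[of "dright w \<zeta> - dleft w \<zeta>"]
    by (simp add: power2_eq_square field_simps)
  also have "\<dots> \<le> 5/2 * (2 * ((norm \<zeta>)\<^sup>2 * (2 * m\<^sup>2) / (Im w)\<^sup>2))"
    using r l by (intro mult_left_mono) auto
  also have "\<dots> = dilatation_BA w * (jac_BA w / (Im w)\<^sup>2) * (norm \<zeta>)\<^sup>2"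
    using jac_BA_pos[OF w] by (simp add: dilatation_BA_def m_def)
  finally show ?thesis .
qed

text \<open>
  The case of a dominating left increment follows from \<open>one_sided_dilatation_bound\<close> for the reflected
  function \<open>\<lambda>x. - f (- x)\<close>.
\<close>

lemma dilatation_BA_le_distortion:
  assumes w: "0 < Im w"
  shows "dilatation_BA w \<le> 40 * sym_distortion (Re w) (Im w) \<or>
    (\<exists>\<sigma>\<in>{-1, 1}. \<forall>s\<in>{1/8..1/4}.
      dilatation_BA w \<le> 160 * sym_distortion (Re w + \<sigma> * s * Im w) ((1/2 + s) * Im w))"
proof (cases "left_incr w \<le> right_incr w")
  case True
  then have eq: "dilatation_BA w = 10 * ((right_incr w)\<^sup>2 / jac_BA w)"
    by (simp add: dilatation_BA_def max_absorb1)
  from one_sided_dilatation_bound[OF cont_f mono_f w, of "Re w"] True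
  consider "(right_incr w)\<^sup>2 / jac_BA w \<le> 4 * (right_incr w / left_incr w)"
    | "\<forall>s\<in>{1/8..1/4}. (right_incr w)\<^sup>2 / jac_BA w \<le>
      16 * ((f (Re w - s * Im w + (1/2 + s) * Im w) - f (Re w - s * Im w)) /
        (f (Re w - s * Im w) - f (Re w - s * Im w - (1/2 + s) * Im w)))"
    unfolding jac_BA_def right_incr_def left_incr_def right_gap_def left_gap_def right_mean_def left_mean_def
    by blast
  then show ?thesis
  proof cases
    case 1
    moreover have "right_incr w / left_incr w \<le> sym_distortion (Re w) (Im w)"
      by (simp add: sym_distortion_def right_incr_def left_incr_def)
    ultimately show ?thesis unfolding eq by linarith
  next
    case 2
    have "dilatation_BA w \<le> 160 * sym_distortion (Re w + (-1) * s * Im w) ((1/2 + s) * Im w)"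
      if "s \<in> {1/8..1/4}" for s
    proof -
      have "(f (Re w - s * Im w + (1/2 + s) * Im w) - f (Re w - s * Im w)) /
        (f (Re w - s * Im w) - f (Re w - s * Im w - (1/2 + s) * Im w))
        \<le> sym_distortion (Re w + (-1) * s * Im w) ((1/2 + s) * Im w)"
        by (simp add: sym_distortion_def)
      with bspec[OF 2 that] show ?thesis unfolding eq by linarith
    qed
    then show ?thesis by blast
  qed
next
  case False
  then have eq: "dilatation_BA w = 10 * ((left_incr w)\<^sup>2 / jac_BA w)"
    by (simp add: dilatation_BA_def max_absorb2)
  define f' where "f' x = - f (- x)" for x
  have cont': "continuous_on UNIV f'"
    unfolding f'_def by (intro continuous_intros cont_f_compose)
  have mono': "strict_mono f'"
    using strict_monoD[OF mono_f] by (auto simp: f'_def strict_mono_def)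
  have R: "right_mean w = - line_mean f' (- Re w - Im w) (- Re w)"
    using line_mean_reflect[OF cont_f, of "Re w" "Re w + Im w"] w
    by (simp add: right_mean_def f'_def[abs_def])
  have L: "left_mean w = - line_mean f' (- Re w) (- Re w + Im w)"
    using line_mean_reflect[OF cont_f, of "Re w - Im w" "Re w"] w
    by (simp add: left_mean_def f'_def[abs_def])
  have tr: "right_incr w = f' (- Re w) - f' (- Re w - Im w)" "left_incr w = f' (- Re w + Im w) - f' (- Re w)"
    "left_gap w = f' (- Re w + Im w) - line_mean f' (- Re w) (- Re w + Im w)"
    "right_gap w = line_mean f' (- Re w - Im w) (- Re w) - f' (- Re w - Im w)"
    by (simp_all add: right_incr_def left_incr_def right_gap_def left_gap_def R L) (simp_all add: f'_def add.commute)
  have jac': "jac_BA w = left_incr w * right_gap w + left_gap w * right_incr w"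
    by (simp add: jac_BA_def mult.commute)
  from one_sided_dilatation_bound[OF cont' mono' w, of "- Re w"] False
  consider "(left_incr w)\<^sup>2 / jac_BA w \<le> 4 * (left_incr w / right_incr w)"
    | "\<forall>s\<in>{1/8..1/4}. (left_incr w)\<^sup>2 / jac_BA w \<le>
      16 * ((f' (- Re w - s * Im w + (1/2 + s) * Im w) - f' (- Re w - s * Im w)) /
        (f' (- Re w - s * Im w) - f' (- Re w - s * Im w - (1/2 + s) * Im w)))"
    unfolding jac' tr by linarith
  then show ?thesis
  proof cases
    case 1
    moreover have "left_incr w / right_incr w \<le> sym_distortion (Re w) (Im w)"
      by (simp add: sym_distortion_def right_incr_def left_incr_def)
    ultimately show ?thesis unfolding eq by linarith
  next
    case 2
    have "dilatation_BA w \<le> 160 * sym_distortion (Re w + 1 * s * Im w) ((1/2 + s) * Im w)"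
      if "s \<in> {1/8..1/4}" for s
    proof -
      have "(f' (- Re w - s * Im w + (1/2 + s) * Im w) - f' (- Re w - s * Im w)) /
        (f' (- Re w - s * Im w) - f' (- Re w - s * Im w - (1/2 + s) * Im w))
        \<le> sym_distortion (Re w + 1 * s * Im w) ((1/2 + s) * Im w)"
        by (simp add: sym_distortion_def f'_def algebra_simps)
      with bspec[OF 2 that] show ?thesis unfolding eq by linarith
    qed
    then show ?thesis by blast
  qed
qed

end

text \<open>
  Chebyshev's inequality; \<open>I + 1\<close> instead of \<open>I\<close> gives room for a strict inequality in the
  contradiction.
\<close>

lemma exists_point_below_mean:
  fixes g :: "real \<Rightarrow> real" and G :: "real \<Rightarrow> ennreal"
  assumes gG: "\<And>x. x \<in> S \<Longrightarrow> ennreal (g x) \<le> G x"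
    and int: "(\<integral>\<^sup>+x. G x * indicator S x \<partial>lborel) \<le> ennreal I" and I: "0 \<le> I"
    and \<delta>: "0 < \<delta>" and sub: "{a..a + \<delta>} \<subseteq> S"
  shows "\<exists>z\<in>{a..a + \<delta>}. g z \<le> (I + 1) / \<delta>"
proof (rule ccontr)
  assume "\<not> ?thesis"
  then have less: "(I + 1) / \<delta> < g z" if "z \<in> {a..a + \<delta>}" for z
    using that by force
  have "ennreal (I + 1) = ennreal ((I + 1) / \<delta>) * emeasure lborel {a..a + \<delta>}"
    using \<delta> I by (simp add: ennreal_mult[symmetric])
  also have "\<dots> = (\<integral>\<^sup>+x. ennreal ((I + 1) / \<delta>) * indicator {a..a + \<delta>} x \<partial>lborel)"
    by (simp add: nn_integral_cmult_indicator)
  also have "\<dots> \<le> (\<integral>\<^sup>+x. G x * indicator S x \<partial>lborel)"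
  proof (rule nn_integral_mono)
    fix x
    show "ennreal ((I + 1) / \<delta>) * indicator {a..a + \<delta>} x \<le> G x * indicator S x"
    proof (cases "x \<in> {a..a + \<delta>}")
      case True
      then have "ennreal ((I + 1) / \<delta>) \<le> ennreal (g x)"
        using less by (intro ennreal_leI) (simp add: less_imp_le)
      also have "\<dots> \<le> G x" using True sub by (intro gG) auto
      finally show ?thesis using True sub by (auto simp: indicator_def)
    qed simp
  qed
  also note int
  finally show False using I by simp
qed

context circle_lift
begin

lemma cont_dilatation_BA: "continuous_on {w. 0 < Im w} dilatation_BA"
proof -
  have "jac_BA w \<noteq> 0" if "0 < Im w" for w using jac_BA_pos[OF that] by simp
  then show ?thesis
    unfolding dilatation_BA_def jac_BA_def
    by (intro continuous_intros continuous_on_subset[OF cont_incr_gap(1)]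
      continuous_on_subset[OF cont_incr_gap(2)] continuous_on_subset[OF cont_incr_gap(3)]
      continuous_on_subset[OF cont_incr_gap(4)]) auto
qed

text \<open>
  With the exponent \<open>1 / (640 * M)\<close>, the factor 40 in front of the distortion at \<open>(x, y)\<close> becomes the power
  \<open>1/16\<close> of \<open>(1 + g x) / y\<close>, and the factor 160 in front of the shifted distortion becomes the power \<open>1/4\<close> of
  \<open>C1 / y\<^sup>2\<close>. In both cases the singularity in \<open>y\<close> is at most \<open>y powr (-1/2)\<close>. At heights bounded away from
  \<open>0\<close> the dilatation is bounded by compactness.

  The majorant \<open>G\<close> is there because \<open>g\<close> is merely Lebesgue measurable, and the bound is later integrated
  by Fubini's theorem for Borel functions. It takes values in \<^typ>\<open>ennreal\<close> so that it can dominate \<open>g\<close> at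
  every point, not just almost everywhere.
\<close>

lemma exp_dilatation_BA_bound:
  fixes g :: "real \<Rightarrow> real" and G :: "real \<Rightarrow> ennreal"
  assumes M: "0 < M" and t0: "0 < t0"
    and g: "\<And>x. x \<in> {-2*pi..2*pi} \<Longrightarrow> 0 \<le> g x"
    and dist: "\<And>x t. x \<in> {-2*pi..2*pi} \<Longrightarrow> 0 < t \<Longrightarrow> t < t0 \<Longrightarrow>
      sym_distortion x t \<le> M * ln ((1 + g x) / t)"
    and gG: "\<And>x. x \<in> {-2*pi..2*pi} \<Longrightarrow> ennreal (g x) \<le> G x"
    and int: "(\<integral>\<^sup>+x. G x * indicator {-2*pi..2*pi} x \<partial>lborel) < \<infinity>"
  obtains C where "0 < C" "\<And>w. Re w \<in> {-3/2*pi..3/2*pi} \<Longrightarrow> 0 < Im w \<Longrightarrow> Im w \<le> 2 * pi \<Longrightarrow>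
    ennreal (exp (dilatation_BA w / (640 * M))) \<le> ennreal C * (1 + G (Re w)) * ennreal (Im w powr (-1/2))"
proof -
  define I where "I = enn2real (\<integral>\<^sup>+x. G x * indicator {-2*pi..2*pi} x \<partial>lborel)"
  have I: "0 \<le> I" "(\<integral>\<^sup>+x. G x * indicator {-2*pi..2*pi} x \<partial>lborel) \<le> ennreal I"
    using int by (auto simp: I_def)
  define y0 where "y0 = min 1 t0"
  have y0: "0 < y0" "y0 \<le> 1" "y0 \<le> t0" using t0 by (auto simp: y0_def)
  define Q where "Q = cbox (Complex (-3/2*pi) y0) (Complex (3/2*pi) (2*pi))"
  have "continuous_on Q dilatation_BA"
    by (rule continuous_on_subset[OF cont_dilatation_BA]) (use y0 in \<open>auto simp: Q_def in_cbox_complex_iff\<close>)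
  then have "bounded (dilatation_BA ` Q)"
    by (intro compact_imp_bounded compact_continuous_image) (auto simp: Q_def)
  then obtain K0 where "\<forall>k\<in>dilatation_BA ` Q. norm k \<le> K0"
    unfolding bounded_iff by blast
  then have K0: "dilatation_BA w \<le> K0" if "w \<in> Q" for w
    using that by (force simp: abs_le_iff)
  define C0 where "C0 = exp (K0 / (640 * M)) / (2 * pi) powr (-1/2)"
  define C1 where "C1 = 18 + 16 * I"
  define C where "C = C0 + 1 + C1 powr (1/4)"
  have C0: "0 < C0" and C1: "0 < C1" using I by (auto simp: C0_def C1_def)
  have C: "0 < C" "C0 \<le> C" "1 \<le> C" "C1 powr (1/4) \<le> C"
    using C0 by (auto simp: C_def add_pos_nonneg)
  have p1: "1 \<le> 1 + G x" for x by simp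
  have main: "ennreal (exp (dilatation_BA w / (640 * M))) \<le> ennreal C * (1 + G (Re w)) * ennreal (Im w powr (-1/2))"
    if x: "Re w \<in> {-3/2*pi..3/2*pi}" and y: "0 < Im w" "Im w \<le> 2 * pi" for w
  proof -
    define x where "x = Re w"
    define y where "y = Im w"
    \<comment> \<open>since \<open>1 \<le> 1 + G (Re w)\<close>, a bound in terms of the height alone is enough\<close>
    have easy: ?thesis if "exp (dilatation_BA w / (640 * M)) \<le> C * (Im w powr (-1/2))"
    proof -
      have "ennreal (exp (dilatation_BA w / (640 * M))) \<le> ennreal C * ennreal (Im w powr (-1/2))"
        using that C(1) by (simp add: ennreal_mult[symmetric])
      also have "\<dots> = ennreal C * 1 * ennreal (Im w powr (-1/2))" by simp
      also have "\<dots> \<le> ennreal C * (1 + G (Re w)) * ennreal (Im w powr (-1/2))"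
        by (intro mult_right_mono mult_left_mono p1) auto
      finally show ?thesis .
    qed
    show ?thesis
    proof (cases "y0 \<le> y")
      case True
      then have "w \<in> Q" using x y by (simp add: Q_def in_cbox_complex_iff y_def)
      then have "exp (dilatation_BA w / (640 * M)) \<le> exp (K0 / (640 * M))"
        using K0 M by (simp add: divide_right_mono)
      also have "\<dots> = C0 * (2 * pi) powr (-1/2)" by (simp add: C0_def)
      also have "\<dots> \<le> C * (Im w powr (-1/2))"
        using C C0 y by (intro mult_mono powr_mono2') auto
      finally show ?thesis by (rule easy)
    next
      case False
      then have yy: "0 < y" "y < 1" "y < t0" using y y0 by (auto simp: y_def)
      have pi4: "1/4 \<le> pi / 2" using pi_gt3 by simp
      have xS: "x \<in> {-2*pi..2*pi}"
        using that(1) pi4 by (auto simp: x_def)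
      from dilatation_BA_le_distortion[of w] y
      consider "dilatation_BA w \<le> 40 * sym_distortion x y"
        | \<sigma> where "\<sigma> \<in> {-1, 1}" "\<And>s. s \<in> {1/8..1/4} \<Longrightarrow>
            dilatation_BA w \<le> 160 * sym_distortion (x + \<sigma> * s * y) ((1/2 + s) * y)"
        unfolding x_def y_def by blast
      then show ?thesis
      proof cases
        case 1
        define u where "u = 1 + g x"
        have u: "1 \<le> u" using g[OF xS] by (simp add: u_def)
        have "dilatation_BA w \<le> 40 * (M * ln (u / y))"
          using 1 dist[OF xS yy(1,3)] unfolding u_def by linarith
        then have "dilatation_BA w / (640 * M) \<le> 1/16 * ln (u / y)"
          using M by (simp add: field_simps)
        then have "exp (dilatation_BA w / (640 * M)) \<le> (u / y) powr (1/16)"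
          using u yy by (simp add: powr_def)
        also have "\<dots> = u powr (1/16) * y powr (-1/16)"
          using u yy by (simp add: powr_divide powr_minus_divide)
        also have "\<dots> \<le> u powr 1 * y powr (-1/2)"
          using u yy by (intro mult_mono powr_mono powr_mono') auto
        finally have "exp (dilatation_BA w / (640 * M)) \<le> u * y powr (-1/2)"
          using u by simp
        then have "ennreal (exp (dilatation_BA w / (640 * M))) \<le> 1 * ennreal u * ennreal (y powr (-1/2))"
          using u by (simp add: ennreal_mult[symmetric])
        also have "\<dots> \<le> ennreal C * (1 + G x) * ennreal (y powr (-1/2))"
        proof (intro mult_right_mono mult_mono)
          show "ennreal u \<le> 1 + G x"
            using gG[OF xS] g[OF xS] by (simp add: u_def ennreal_plus add_left_mono)
          show "1 \<le> ennreal C" using C by simp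
        qed auto
        finally show ?thesis by (simp add: x_def y_def)
      next
        case 2
        \<comment> \<open>\<open>{a..a + y/8}\<close> is the range of the centre \<open>x + \<sigma> * s * y\<close> for \<open>s\<close> in \<open>{1/8..1/4}\<close>\<close>
        define a where "a = (if \<sigma> = 1 then x + y / 8 else x - y / 4)"
        have sub: "{a..a + y/8} \<subseteq> {-2*pi..2*pi}"
        proof -
          have "x - y/4 \<ge> -2*pi" "x + y/4 \<le> 2*pi"
            using that(1) pi4 yy by (auto simp: x_def)
          then show ?thesis using yy by (auto simp: a_def)
        qed
        obtain z where z: "z \<in> {a..a + y/8}" "g z \<le> (I + 1) / (y/8)"
          using exists_point_below_mean[OF gG I(2,1) _ sub] yy by auto
        define s where "s = \<sigma> * (z - x) / y"
        have zs: "z = x + \<sigma> * s * y"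
          using yy 2(1) by (auto simp: s_def)
        have s: "s \<in> {1/8..1/4}"
          using z(1) yy 2(1) by (auto simp: s_def a_def field_simps split: if_splits)
        define r where "r = (1/2 + s) * y"
        have r: "y / 2 \<le> r" "r \<le> 3/4 * y"
          using s yy mult_right_mono[of "1/2" "1/2 + s" y] mult_right_mono[of "1/2 + s" "3/4" y] by (auto simp: r_def)
        have zS: "z \<in> {-2*pi..2*pi}" using z(1) sub by blast
        have "dilatation_BA w \<le> 160 * sym_distortion z r"
          using 2(2)[OF s] by (simp add: zs r_def)
        also have "\<dots> \<le> 160 * (M * ln ((1 + g z) / r))"
          using dist[OF zS, of r] r yy by simp
        finally have K: "dilatation_BA w \<le> 160 * (M * ln ((1 + g z) / r))" .
        \<comment> \<open>\<open>1 \<le> 1 / y\<close>, and the two numerators add up to \<open>(9 + 8 * I) / y\<close>\<close>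
        have "(1 + g z) / r \<le> (1 / y + (I + 1) / (y/8)) / (y / 2)"
          using z(2) r yy I(1) by (intro frac_le add_mono) auto
        also have "\<dots> = C1 / y\<^sup>2"
          using yy by (simp add: C1_def field_simps power2_eq_square)
        finally have "ln ((1 + g z) / r) \<le> ln (C1 / y\<^sup>2)"
          using g[OF zS] r yy by (intro ln_mono divide_pos_pos) auto
        then have "M * ln ((1 + g z) / r) \<le> M * ln (C1 / y\<^sup>2)"
          using M by (intro mult_left_mono) auto
        with K have "dilatation_BA w \<le> 160 * (M * ln (C1 / y\<^sup>2))" by linarith
        then have "dilatation_BA w / (640 * M) \<le> 1/4 * ln (C1 / y\<^sup>2)"
          using M by (simp add: field_simps)
        then have "exp (dilatation_BA w / (640 * M)) \<le> (C1 / y\<^sup>2) powr (1/4)"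
          using C1 yy by (simp add: powr_def)
        also have "\<dots> = C1 powr (1/4) * y powr (-1/2)"
        proof -
          have "(y\<^sup>2) powr (1/4) = y powr (1/2)"
            using yy by (simp add: powr_powr flip: powr_numeral)
          then show ?thesis using C1 yy by (simp add: powr_divide powr_minus_divide)
        qed
        also have "\<dots> \<le> C * y powr (-1/2)"
          using C by (intro mult_right_mono) auto
        finally show ?thesis by (intro easy) (simp add: y_def)
      qed
    qed
  qed
  show ?thesis by (rule that[OF C(1) main])
qed

end

section \<open>Integrals over the disk in the angular variable\<close>

lemma nn_integral_complex:
  assumes [measurable]: "\<phi> \<in> borel_measurable borel"
  shows "(\<integral>\<^sup>+z. \<phi> z \<partial>lborel) = (\<integral>\<^sup>+x. \<integral>\<^sup>+y. \<phi> (Complex x y) \<partial>lborel \<partial>lborel)"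
proof -
  have "(\<integral>\<^sup>+z. \<phi> z \<partial>lborel) = (\<integral>\<^sup>+p. \<phi> (Complex (fst p) (snd p)) \<partial>(lborel \<Otimes>\<^sub>M lborel))"
    by (subst lborel_complex_eq_distr) (simp add: nn_integral_distr)
  then show ?thesis
    by (simp add: lborel.nn_integral_fst[symmetric])
qed

text \<open>
  The substitution \<open>\<theta> = arctan \<tau>\<close>, on bounded intervals first.
\<close>

lemma nn_integral_arctan_le:
  assumes [measurable]: "G \<in> borel_measurable borel"
  shows "(\<integral>\<^sup>+\<tau>. G (arctan \<tau>) * ennreal (1 / (1 + \<tau>\<^sup>2)) \<partial>lborel) \<le>
    (\<integral>\<^sup>+\<theta>. G \<theta> * indicator {-pi/2..pi/2} \<theta> \<partial>lborel)"
proof -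
  have "(\<integral>\<^sup>+\<tau>. G (arctan \<tau>) * ennreal (1 / (1 + \<tau>\<^sup>2)) * indicator {-real n..real n} \<tau> \<partial>lborel) \<le>
    (\<integral>\<^sup>+\<theta>. G \<theta> * indicator {-pi/2..pi/2} \<theta> \<partial>lborel)" for n
  proof (cases "n = 0")
    case True
    have "AE \<tau> in lborel. G (arctan \<tau>) * ennreal (1 / (1 + \<tau>\<^sup>2)) * indicator {-real n..real n} \<tau> = 0"
      using AE_lborel_singleton[of "0::real"] by eventually_elim (auto simp: True indicator_def)
    then have "(\<integral>\<^sup>+\<tau>. G (arctan \<tau>) * ennreal (1 / (1 + \<tau>\<^sup>2)) * indicator {-real n..real n} \<tau> \<partial>lborel) = 0"
      by (subst nn_integral_0_iff_AE) auto
    then show ?thesis by simp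
  next
    case False
    have "(\<integral>\<^sup>+\<theta>. G \<theta> * indicator {arctan (-real n)..arctan (real n)} \<theta> \<partial>lborel) =
      (\<integral>\<^sup>+\<tau>. G (arctan \<tau>) * ennreal (1 / (1 + \<tau>\<^sup>2)) * indicator {-real n..real n} \<tau> \<partial>lborel)"
    proof (rule nn_integral_substitution_aux)
      show "(arctan has_real_derivative 1 / (1 + \<tau>\<^sup>2)) (at \<tau>)" for \<tau>
        using DERIV_arctan[of \<tau>] by (simp add: inverse_eq_divide)
      show "continuous_on {-real n..real n} (\<lambda>\<tau>. 1 / (1 + \<tau>\<^sup>2))"
        by (intro continuous_intros) (auto simp: add_nonneg_eq_0_iff)
    qed (use False in auto)
    moreover have "{arctan (-real n)..arctan (real n)} \<subseteq> {-pi/2..pi/2}"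
      using arctan_lbound[of "- real n"] arctan_ubound[of "real n"] by auto
    then have "(\<integral>\<^sup>+\<theta>. G \<theta> * indicator {arctan (-real n)..arctan (real n)} \<theta> \<partial>lborel) \<le>
      (\<integral>\<^sup>+\<theta>. G \<theta> * indicator {-pi/2..pi/2} \<theta> \<partial>lborel)"
      by (intro nn_integral_mono mult_left_mono) (auto simp: indicator_def)
    ultimately show ?thesis by simp
  qed
  note bound = this
  have "(\<integral>\<^sup>+\<tau>. G (arctan \<tau>) * ennreal (1 / (1 + \<tau>\<^sup>2)) \<partial>lborel) =
    (\<integral>\<^sup>+\<tau>. (SUP n. G (arctan \<tau>) * ennreal (1 / (1 + \<tau>\<^sup>2)) * indicator {-real n..real n} \<tau>) \<partial>lborel)"
  proof (rule nn_integral_cong)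
    fix \<tau> :: real
    have "(SUP n. indicator {-real n..real n} \<tau> :: ennreal) = 1"
    proof (rule antisym)
      obtain n where "\<bar>\<tau>\<bar> \<le> real n" using real_arch_simple by blast
      then have "indicator {-real n..real n} \<tau> = (1::ennreal)" by (auto simp: indicator_def)
      then show "1 \<le> (SUP n. indicator {-real n..real n} \<tau> :: ennreal)"
        by (intro SUP_upper2[of n]) auto
    qed (auto intro!: SUP_least simp: indicator_def)
    then show "G (arctan \<tau>) * ennreal (1 / (1 + \<tau>\<^sup>2)) =
        (SUP n. G (arctan \<tau>) * ennreal (1 / (1 + \<tau>\<^sup>2)) * indicator {-real n..real n} \<tau>)"
      by (simp add: SUP_mult_left_ennreal[symmetric])
  qed
  also have "\<dots> = (SUP n. \<integral>\<^sup>+\<tau>. G (arctan \<tau>) * ennreal (1 / (1 + \<tau>\<^sup>2)) * indicator {-real n..real n} \<tau> \<partial>lborel)"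
  proof (rule nn_integral_monotone_convergence_SUP)
    show "incseq (\<lambda>n \<tau>. G (arctan \<tau>) * ennreal (1 / (1 + \<tau>\<^sup>2)) * indicator {-real n..real n} \<tau>)"
      by (intro incseq_SucI le_funI mult_left_mono) (auto simp: indicator_def)
  qed auto
  also have "\<dots> \<le> (\<integral>\<^sup>+\<theta>. G \<theta> * indicator {-pi/2..pi/2} \<theta> \<partial>lborel)"
    by (rule SUP_least) (rule bound)
  finally show ?thesis .
qed

lemma nn_integral_inverse_sqrt:
  "(\<integral>\<^sup>+u. ennreal ((1 - u) powr (-1/2)) * indicator {0<..<1} u \<partial>lborel) \<le> 2"
proof -
  have "((\<lambda>x. x powr (-1/2)) has_integral 1 powr (-1/2 + 1) / (-1/2 + 1)) {0..1::real}"
    by (rule has_integral_powr_from_0) auto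
  then have "(\<integral>\<^sup>+u. ennreal (u powr (-1/2)) * indicator {0..1} u \<partial>lborel) = 2"
    by (subst nn_integral_has_integral_lebesgue') auto
  moreover have "(\<integral>\<^sup>+u. ennreal ((1 - u) powr (-1/2)) * indicator {0<..<1} u \<partial>lborel) =
     (\<integral>\<^sup>+u. ennreal (u powr (-1/2)) * indicator {0<..<1} u \<partial>lborel)"
    by (subst (2) nn_integral_real_affine[of _ "-1" 1])
      (auto intro!: nn_integral_cong simp: indicator_def)
  moreover have "\<dots> \<le> (\<integral>\<^sup>+u. ennreal (u powr (-1/2)) * indicator {0..1} u \<partial>lborel)"
    by (intro nn_integral_mono mult_left_mono) (auto simp: indicator_def)
  ultimately show ?thesis by simp
qed

text \<open>
  A substitute for polar coordinates that only needs linear substitutions on lines: a point of the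
  right half-plane is written as \<open>x * (1 + \<i> * \<tau>)\<close>, with area element \<open>x dx d\<tau>\<close>. Its angle \<open>arctan \<tau>\<close> is
  free of \<open>x\<close>, and its modulus is \<open>x * c \<tau>\<close>, so for fixed \<open>\<tau>\<close> the integral in \<open>x\<close> is elementary and bounded
  by \<open>2 / (1 + \<tau>\<^sup>2)\<close>, which is twice the derivative of \<open>arctan\<close>.
\<close>

lemma nn_integral_half_disk_le:
  assumes [measurable]: "G \<in> borel_measurable borel"
  shows "(\<integral>\<^sup>+z. G (arctan (Im z / Re z)) * ennreal ((1 - norm z) powr (-1/2)) *
      indicator {z. 0 < Re z \<and> norm z < 1} z \<partial>lborel) \<le>
    2 * (\<integral>\<^sup>+\<theta>. G \<theta> * indicator {-pi/2..pi/2} \<theta> \<partial>lborel)"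
proof -
  define c where "c \<tau> = sqrt (1 + \<tau>\<^sup>2)" for \<tau> :: real
  have c: "1 \<le> c \<tau>" "0 < c \<tau>" for \<tau>
    by (auto simp: c_def intro: add_pos_nonneg)
  have [measurable]: "c \<in> borel_measurable borel" unfolding c_def by measurable
  define k where "k x \<tau> = ennreal x * ennreal ((1 - x * c \<tau>) powr (-1/2)) *
      indicator {x. 0 < x \<and> x * c \<tau> < 1} x" for x \<tau>
  have [measurable]: "case_prod k \<in> borel_measurable (lborel \<Otimes>\<^sub>M lborel)"
    unfolding k_def by measurable
  define \<phi> where "\<phi> z = G (arctan (Im z / Re z)) * ennreal ((1 - norm z) powr (-1/2)) *
      indicator {z. 0 < Re z \<and> norm z < 1} z" for z
  have \<phi>_meas[measurable]: "\<phi> \<in> borel_measurable borel" unfolding \<phi>_def by measurable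
  have slice: "(\<integral>\<^sup>+y. \<phi> (Complex x y) \<partial>lborel) = (\<integral>\<^sup>+\<tau>. G (arctan \<tau>) * k x \<tau> \<partial>lborel)" for x
  proof (cases "0 < x")
    case True
    have "norm (Complex x (x * \<tau>)) = x * c \<tau>" for \<tau>
    proof -
      have "norm (Complex x (x * \<tau>)) = sqrt (x\<^sup>2 * (1 + \<tau>\<^sup>2))"
        by (simp add: complex_norm power_mult_distrib algebra_simps)
      then show ?thesis using True by (simp add: real_sqrt_mult c_def)
    qed
    then have eq: "ennreal \<bar>x\<bar> * \<phi> (Complex x (0 + x * \<tau>)) = G (arctan \<tau>) * k x \<tau>" for \<tau>
      using True by (auto simp: \<phi>_def k_def indicator_def mult_ac)
    have [measurable]: "(\<lambda>y. \<phi> (Complex x y)) \<in> borel_measurable borel"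
      unfolding Complex_eq by measurable
    have "(\<integral>\<^sup>+y. \<phi> (Complex x y) \<partial>lborel) = ennreal \<bar>x\<bar> * (\<integral>\<^sup>+\<tau>. \<phi> (Complex x (0 + x * \<tau>)) \<partial>lborel)"
      using True by (intro nn_integral_real_affine) auto
    also have "\<dots> = (\<integral>\<^sup>+\<tau>. ennreal \<bar>x\<bar> * \<phi> (Complex x (0 + x * \<tau>)) \<partial>lborel)"
      unfolding Complex_eq by (subst nn_integral_cmult) auto
    finally show ?thesis by (simp only: eq)
  next
    case False
    then show ?thesis by (simp add: \<phi>_def k_def indicator_def)
  qed
  have ray: "(\<integral>\<^sup>+x. k x \<tau> \<partial>lborel) \<le> 2 * ennreal (1 / (1 + \<tau>\<^sup>2))" for \<tau>
  proof -
    have "(\<integral>\<^sup>+x. k x \<tau> \<partial>lborel) = ennreal \<bar>1 / c \<tau>\<bar> * (\<integral>\<^sup>+u. k (0 + 1 / c \<tau> * u) \<tau> \<partial>lborel)"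
      using c(2)[of \<tau>] by (intro nn_integral_real_affine) (auto simp: k_def)
    also have "\<dots> \<le> ennreal \<bar>1 / c \<tau>\<bar> * (\<integral>\<^sup>+u. ennreal (1 / c \<tau>) *
        (ennreal ((1 - u) powr (-1/2)) * indicator {0<..<1} u) \<partial>lborel)"
    proof (intro mult_left_mono nn_integral_mono)
      fix u :: real
      show "k (0 + 1 / c \<tau> * u) \<tau> \<le> ennreal (1 / c \<tau>) * (ennreal ((1 - u) powr (-1/2)) * indicator {0<..<1} u)"
        using c[of \<tau>] 
        by (auto simp: k_def indicator_def zero_less_divide_iff intro!: mult_right_mono ennreal_leI divide_right_mono)
    qed simp
    also have "\<dots> = ennreal \<bar>1 / c \<tau>\<bar> * (ennreal (1 / c \<tau>) *
        (\<integral>\<^sup>+u. ennreal ((1 - u) powr (-1/2)) * indicator {0<..<1} u \<partial>lborel))"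
      by (subst nn_integral_cmult) auto
    also have "\<dots> \<le> ennreal \<bar>1 / c \<tau>\<bar> * (ennreal (1 / c \<tau>) * 2)"
      by (intro mult_left_mono nn_integral_inverse_sqrt) auto
    also have "\<dots> = 2 * (ennreal (1 / c \<tau>) * ennreal (1 / c \<tau>))"
      using c(2)[of \<tau>] by (simp add: mult_ac)
    also have "ennreal (1 / c \<tau>) * ennreal (1 / c \<tau>) = ennreal (1 / (1 + \<tau>\<^sup>2))"
    proof -
      have "1 / c \<tau> * (1 / c \<tau>) = 1 / (1 + \<tau>\<^sup>2)"
        by (simp add: c_def)
      then show ?thesis using c(2)[of \<tau>] by (simp add: ennreal_mult[symmetric])
    qed
    finally show ?thesis .
  qed
  have "(\<integral>\<^sup>+z. \<phi> z \<partial>lborel) = (\<integral>\<^sup>+x. \<integral>\<^sup>+\<tau>. G (arctan \<tau>) * k x \<tau> \<partial>lborel \<partial>lborel)"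
    by (simp add: nn_integral_complex slice)
  also have "\<dots> = (\<integral>\<^sup>+\<tau>. \<integral>\<^sup>+x. G (arctan \<tau>) * k x \<tau> \<partial>lborel \<partial>lborel)"
    by (rule lborel_pair.Fubini'[symmetric]) measurable
  also have "\<dots> = (\<integral>\<^sup>+\<tau>. G (arctan \<tau>) * (\<integral>\<^sup>+x. k x \<tau> \<partial>lborel) \<partial>lborel)"
    by (intro nn_integral_cong nn_integral_cmult) (auto simp: k_def)
  also have "\<dots> \<le> (\<integral>\<^sup>+\<tau>. G (arctan \<tau>) * (2 * ennreal (1 / (1 + \<tau>\<^sup>2))) \<partial>lborel)"
    by (intro nn_integral_mono mult_left_mono ray) auto
  also have "\<dots> = 2 * (\<integral>\<^sup>+\<tau>. G (arctan \<tau>) * ennreal (1 / (1 + \<tau>\<^sup>2)) \<partial>lborel)"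
    by (subst nn_integral_cmult[symmetric]) (auto simp: mult_ac)
  also have "\<dots> \<le> 2 * (\<integral>\<^sup>+\<theta>. G \<theta> * indicator {-pi/2..pi/2} \<theta> \<partial>lborel)"
    by (intro mult_left_mono nn_integral_arctan_le) auto
  finally show ?thesis by (simp add: \<phi>_def)
qed

lemma nn_integral_complex_uminus:
  fixes \<phi> :: "complex \<Rightarrow> ennreal"
  assumes [measurable]: "\<phi> \<in> borel_measurable borel"
  shows "(\<integral>\<^sup>+z. \<phi> (- z) \<partial>lborel) = (\<integral>\<^sup>+z. \<phi> z \<partial>lborel)"
proof -
  have refl: "(\<integral>\<^sup>+x. \<psi> (- x) \<partial>lborel) = (\<integral>\<^sup>+x. \<psi> x \<partial>lborel)"
    if [measurable]: "\<psi> \<in> borel_measurable borel" for \<psi> :: "real \<Rightarrow> ennreal"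
    by (subst (2) nn_integral_real_affine[of _ "-1" 0]) auto
  have m: "(\<lambda>y. \<phi> (Complex x y)) \<in> borel_measurable borel" for x
    unfolding Complex_eq by measurable
  have "(\<integral>\<^sup>+z. \<phi> (- z) \<partial>lborel) = (\<integral>\<^sup>+x. \<integral>\<^sup>+y. \<phi> (Complex (- x) (- y)) \<partial>lborel \<partial>lborel)"
    by (subst nn_integral_complex) (auto simp: complex_eq_iff intro!: nn_integral_cong arg_cong[where f = \<phi>])
  also have "\<dots> = (\<integral>\<^sup>+x. \<integral>\<^sup>+y. \<phi> (Complex (- x) y) \<partial>lborel \<partial>lborel)"
    by (intro nn_integral_cong refl[of "\<lambda>y. \<phi> (Complex _ y)"] m)
  also have "\<dots> = (\<integral>\<^sup>+x. \<integral>\<^sup>+y. \<phi> (Complex x y) \<partial>lborel \<partial>lborel)"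
  proof (rule refl[of "\<lambda>x. \<integral>\<^sup>+y. \<phi> (Complex x y) \<partial>lborel"])
    have "(\<lambda>p. \<phi> (Complex (fst p) (snd p))) \<in> borel_measurable (lborel \<Otimes>\<^sub>M lborel)" by measurable
    then show "(\<lambda>x. \<integral>\<^sup>+y. \<phi> (Complex x y) \<partial>lborel) \<in> borel_measurable borel"
      using lborel.borel_measurable_nn_integral_fst[of "\<lambda>p. \<phi> (Complex (fst p) (snd p))" lborel] by simp
  qed
  finally show ?thesis by (simp add: nn_integral_complex)
qed

section \<open>The derivative and the dilatation of the disk map\<close>

text \<open>
  The shape of all the fields below: constant on the core, and continuous on the surrounding annulus
  including its inner boundary circle.
\<close>

lemma piecewise_locally_integrable:
  fixes q :: "complex \<Rightarrow> 'a::euclidean_space"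
  assumes r: "r < 1" and cont: "continuous_on {z. r \<le> norm z \<and> norm z < 1} q"
    and const: "\<And>z. norm z < r \<Longrightarrow> q z = c"
  shows "locally_integrable_on (ball 0 1) q"
    "(\<lambda>z. indicator (ball 0 1) z *\<^sub>R q z) \<in> borel_measurable borel"
proof -
  define An where "An = {z::complex. r \<le> norm z \<and> norm z < 1}"
  have "An = ball 0 1 - ball 0 r" by (auto simp: An_def)
  then have An: "An \<in> sets borel" by simp
  have eq: "indicator (ball 0 1) z *\<^sub>R q z = indicator An z *\<^sub>R q z + indicator (ball 0 r) z *\<^sub>R c" for z
    using r const[of z] by (auto simp: An_def indicator_def)
  have m1: "(\<lambda>z. indicator An z *\<^sub>R q z) \<in> borel_measurable borel"
    using borel_measurable_continuous_on_indicator[OF An] cont by (simp add: An_def)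
  show "(\<lambda>z. indicator (ball 0 1) z *\<^sub>R q z) \<in> borel_measurable borel"
    unfolding eq by (intro borel_measurable_add[OF m1] borel_measurable_scaleR borel_measurable_indicator) auto
  show "locally_integrable_on (ball 0 1) q"
    unfolding locally_integrable_on_def
  proof (intro allI impI)
    fix K :: "complex set" assume K: "compact K \<and> K \<subseteq> ball 0 1"
    have "compact (K - ball 0 r)" using K by (intro compact_diff) auto
    moreover have "continuous_on (K - ball 0 r) q"
      by (rule continuous_on_subset[OF cont]) (use K in auto)
    ultimately have 1: "integrable lborel (\<lambda>z. indicator (K - ball 0 r) z *\<^sub>R q z)"
      by (rule borel_integrable_compact)
    have "emeasure lborel (K \<inter> ball 0 r) < \<infinity>"
      using K by (intro emeasure_bounded_finite) (auto intro: bounded_Int compact_imp_bounded)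
    moreover have "K \<inter> ball 0 r \<in> sets lborel"
      using K by (simp add: compact_imp_closed borel_closed)
    ultimately have 2: "integrable lborel (\<lambda>z. indicator (K \<inter> ball 0 r) z *\<^sub>R c)"
      by (intro integrable_scaleR_left integrable_real_indicator) auto
    have "indicator K z *\<^sub>R q z = indicator (K - ball 0 r) z *\<^sub>R q z + indicator (K \<inter> ball 0 r) z *\<^sub>R c" for z
      using const[of z] by (auto simp: indicator_def)
    then have int: "integrable lborel (\<lambda>z. indicator K z *\<^sub>R q z)"
      using Bochner_Integration.integrable_add[OF 1 2] by simp
    then have "integrable lebesgue (\<lambda>z. indicator K z *\<^sub>R q z)"
      using integrable_completion[of "\<lambda>z. indicator K z *\<^sub>R q z" lborel] by simp
    then show "q absolutely_integrable_on K"
      by (simp add: set_integrable_def)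
  qed
qed

lemma qc_dilatation_le:
  assumes "1 \<le> k" "(norm A)\<^sup>2 \<le> k * jac A"
  shows "qc_dilatation A \<le> ennreal k"
  unfolding qc_dilatation_def by (rule Inf_lower) (use assms in auto)

lemma ennreal_exp_le:
  assumes "K \<le> ennreal k" "0 \<le> k" "0 \<le> p"
  shows "ennreal_exp p K \<le> ennreal (exp (p * k))"
proof -
  have "K \<noteq> \<infinity>" using assms(1) by (auto simp: top_unique)
  moreover have "enn2real K \<le> k"
    using assms(1,2) by (simp add: enn2real_leI)
  ultimately show ?thesis
    using assms(3) by (auto simp: ennreal_exp_def intro!: ennreal_leI mult_left_mono)
qed

context circle_lift
begin

text \<open>
  On the circle \<open>norm z = core_radius\<close>, where \<open>disk_ext\<close> may fail to be differentiable, the value is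
  the limit from outside, which keeps \<open>disk_diff\<close> continuous on the closed side of the annulus.
\<close>

definition disk_diff :: "complex \<Rightarrow> complex \<Rightarrow>\<^sub>L complex" where
  "disk_diff z = (if core_radius \<le> norm z
    then Blinfun (\<lambda>\<zeta>. \<i> * disk_ext z * dBA (- \<i> * Ln z) (- \<i> * \<zeta> / z))
    else Blinfun (\<lambda>\<zeta>. cis shift * \<zeta>))"

lemma dBA_linear_combination: "dBA w \<zeta> = Re \<zeta> *\<^sub>R dBA w 1 + Im \<zeta> *\<^sub>R dBA w \<i>"
  by (simp add: dBA_def dright_def dleft_def complex_eq_iff) (simp add: field_simps add_divide_distrib diff_divide_distrib)

lemma disk_diff_inner:
  assumes "norm z < core_radius"
  shows "blinfun_apply (disk_diff z) \<zeta> = cis shift * \<zeta>"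
  using assms by (simp add: disk_diff_def bounded_linear_Blinfun_apply bounded_linear_mult_right)

lemma disk_diff_outer:
  assumes "core_radius \<le> norm z"
  shows "blinfun_apply (disk_diff z) \<zeta> = \<i> * disk_ext z * dBA (- \<i> * Ln z) (- \<i> * \<zeta> / z)"
proof -
  have "bounded_linear (dBA w)" for w
  proof -
    have "dBA w = (\<lambda>\<zeta>. Re \<zeta> *\<^sub>R dBA w 1 + Im \<zeta> *\<^sub>R dBA w \<i>)"
      by (rule ext) (rule dBA_linear_combination)
    then show ?thesis
      by (rule ssubst) (intro bounded_linear_add bounded_linear_scaleR_const bounded_linear_Re bounded_linear_Im)
  qed
  moreover have "bounded_linear (\<lambda>\<zeta>. - \<i> * \<zeta> / z)"
    by (rule bounded_linear_compose[OF bounded_linear_divide bounded_linear_mult_right])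
  ultimately have "bounded_linear (\<lambda>\<zeta>. \<i> * disk_ext z * dBA (- \<i> * Ln z) (- \<i> * \<zeta> / z))"
    by (rule bounded_linear_const_mult[OF bounded_linear_compose])
  then show ?thesis
    using assms by (simp add: disk_diff_def bounded_linear_Blinfun_apply)
qed

lemma has_derivative_disk_ext:
  assumes "norm z < 1" "norm z \<noteq> core_radius"
  shows "(disk_ext has_derivative blinfun_apply (disk_diff z)) (at z)"
proof (cases "norm z < core_radius")
  case True
  have "((\<lambda>z. cis shift * z) has_derivative (\<lambda>\<zeta>. cis shift * \<zeta>)) (at z)"
    by (auto intro!: derivative_eq_intros)
  then have "(disk_ext has_derivative (\<lambda>\<zeta>. cis shift * \<zeta>)) (at z)"
    by (rule has_derivative_transform_within_open[of _ _ z UNIV "ball 0 core_radius"])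
      (use True in \<open>auto simp: disk_ext_core\<close>)
  moreover have "blinfun_apply (disk_diff z) = (\<lambda>\<zeta>. cis shift * \<zeta>)"
    using disk_diff_inner[OF True] by (rule ext)
  ultimately show ?thesis by simp
next
  case False
  then have cr: "core_radius < norm z" using assms by simp
  then have z0: "z \<noteq> 0" using core_radius by auto
  define w where "w = - \<i> * Ln z"
  have w: "0 < Im w" "Im w < 2 * pi"
  proof -
    show "0 < Im w" using assms z0 by (simp add: w_def)
    have "ln core_radius < ln (norm z)" using cr core_radius by (subst ln_less_cancel_iff) auto
    then show "Im w < 2 * pi" using z0 by (simp add: w_def core_radius_def)
  qed
  have "(strip_ext has_derivative dBA w) (at w)"
    by (rule has_derivative_transform_within_open[OF has_derivative_BA[OF w(1)], of "{w. Im w < 2 * pi}"])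
      (use w in \<open>auto simp: strip_ext_def open_halfspace_Im_lt\<close>)
  then have "((\<lambda>u. exp (\<i> * strip_ext u)) has_derivative
      (\<lambda>\<zeta>. \<i> * dBA w \<zeta> * exp (\<i> * strip_ext w))) (at w)"
    using has_derivative_compose[OF has_derivative_mult_right[of strip_ext _ _ \<i>]
        DERIV_exp[unfolded has_field_derivative_def]]
    by (simp add: mult_ac)
  from has_derivative_log_coordinate[of "\<lambda>u. exp (\<i> * strip_ext u)", OF exp_strip_ext_period z0 this[unfolded w_def]]
  have "(disk_ext has_derivative (\<lambda>\<zeta>. \<i> * dBA w (- \<i> * \<zeta> / z) * exp (\<i> * strip_ext w))) (at z)"
    unfolding w_def
    by (rule has_derivative_transform_within_open[of _ _ z UNIV "- {0}"])
      (use z0 in \<open>auto simp: disk_ext_def\<close>)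
  moreover have "blinfun_apply (disk_diff z) = (\<lambda>\<zeta>. \<i> * dBA w (- \<i> * \<zeta> / z) * exp (\<i> * strip_ext w))"
    using disk_diff_outer[of z] cr z0 by (auto simp: w_def disk_ext_def mult_ac)
  ultimately show ?thesis by simp
qed

lemma continuous_disk_diff:
  "continuous_on {z::complex. core_radius \<le> norm z \<and> norm z < 1} (\<lambda>z. blinfun_apply (disk_diff z) v)"
proof -
  have c: "continuous_on {z::complex. core_radius \<le> norm z \<and> norm z < 1} (\<lambda>z. dBA (- \<i> * Ln z) u)" for u
  proof (intro continuous_at_imp_continuous_on ballI)
    fix z :: complex assume z: "z \<in> {z. core_radius \<le> norm z \<and> norm z < 1}"
    then have z0: "z \<noteq> 0" using core_radius by auto
    have "open {w. 0 < Im w}" by (rule open_halfspace_Im_gt)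
    then have "isCont (\<lambda>w. dBA w u) (- \<i> * Ln z)"
      using cont_dBA[OF continuous_on_const, of u] z z0
      by (auto simp: continuous_on_eq_continuous_at)
    then show "isCont (\<lambda>z. dBA (- \<i> * Ln z) u) z"
      by (intro continuous_log_coordinate[of "\<lambda>w. dBA w u"] z0 dBA_period)
  qed
  have "continuous_on {z::complex. core_radius \<le> norm z \<and> norm z < 1}
    (\<lambda>z. \<i> * disk_ext z * (Re (- \<i> * v / z) *\<^sub>R dBA (- \<i> * Ln z) 1 + Im (- \<i> * v / z) *\<^sub>R dBA (- \<i> * Ln z) \<i>))"
    using core_radius by (intro continuous_intros cont_disk_ext c) auto
  then show ?thesis
  proof (rule continuous_on_eq)
    fix z :: complex assume "z \<in> {z. core_radius \<le> norm z \<and> norm z < 1}"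
    then show "\<i> * disk_ext z * (Re (- \<i> * v / z) *\<^sub>R dBA (- \<i> * Ln z) 1 + Im (- \<i> * v / z) *\<^sub>R dBA (- \<i> * Ln z) \<i>)
        = blinfun_apply (disk_diff z) v"
      using dBA_linear_combination[of "- \<i> * Ln z" "- \<i> * v / z"]
      by (simp only: disk_diff_outer mem_Collect_eq)
  qed
qed

lemma weak_differential_disk_ext: "weak_differential (ball 0 1) disk_ext disk_diff"
proof (rule weak_differential_of_line_derivatives[where S = "sphere 0 core_radius"])
  show "(disk_ext has_derivative blinfun_apply (disk_diff z)) (at z)"
    if "z \<in> ball 0 1 - sphere 0 core_radius" for z
    using that by (intro has_derivative_disk_ext) auto
  show "finite {t::real. c + t *\<^sub>R v \<in> sphere 0 core_radius}" if "v \<in> Basis" for c v :: complex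
    using that by (rule finite_line_Int_sphere)
  show "locally_integrable_on (ball 0 1) (\<lambda>z. blinfun_apply (disk_diff z) v)"
    "(\<lambda>z. indicator (ball 0 1) z *\<^sub>R blinfun_apply (disk_diff z) v) \<in> borel_measurable borel" for v
    by (rule piecewise_locally_integrable[OF core_radius(2) continuous_disk_diff disk_diff_inner], assumption)+
qed (use cont_disk_ext in auto)

lemma locally_integrable_jac: "locally_integrable_on (ball 0 1) (\<lambda>z. jac (disk_diff z))"
proof (rule piecewise_locally_integrable)
  show "continuous_on {z::complex. core_radius \<le> norm z \<and> norm z < 1} (\<lambda>z. jac (disk_diff z))"
    unfolding jac_def by (intro continuous_intros continuous_disk_diff)
  show "jac (disk_diff z) = 1" if "norm z < core_radius" for z
    using disk_diff_inner[OF that] by (simp add: jac_def power2_eq_square[symmetric])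
qed (use core_radius in auto)

lemma dilatation_BA_period: "dilatation_BA ((w::complex) + 2 * pi) = dilatation_BA w"
  using line_mean_period[of "Re w" "Re w + Im w"] line_mean_period[of "Re w - Im w" "Re w"]
    period_f[of "Re w"] period_f[of "Re w + Im w"] period_f[of "Re w - Im w"]
  by (simp add: dilatation_BA_def jac_BA_def right_incr_def left_incr_def right_gap_def left_gap_def
      right_mean_def left_mean_def algebra_simps)

lemma qc_dilatation_inner:
  assumes "norm z < core_radius"
  shows "qc_dilatation (disk_diff z) \<le> 1"
proof -
  have "norm (disk_diff z) \<le> 1"
    by (rule norm_blinfun_bound) (simp_all add: disk_diff_inner[OF assms] norm_mult)
  moreover have "jac (disk_diff z) = 1"
    using disk_diff_inner[OF assms] by (simp add: jac_def power2_eq_square[symmetric])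
  ultimately have "(norm (disk_diff z))\<^sup>2 \<le> 1 * jac (disk_diff z)"
    by (simp add: power_le_one)
  from qc_dilatation_le[OF _ this] show ?thesis by simp
qed

text \<open>
  In the coordinate \<open>w = - \<i> * Ln z\<close> the derivative is \<open>\<zeta> \<mapsto> a * dBA w (b * \<zeta>)\<close>. The complex factors \<open>a\<close>
  and \<open>b\<close> multiply the square of the norm and the Jacobian by the same number.
\<close>

lemma qc_dilatation_outer:
  assumes z: "core_radius \<le> norm z" "norm z < 1"
  shows "qc_dilatation (disk_diff z) \<le> ennreal (max 1 (dilatation_BA (- \<i> * Ln z)))"
proof (rule qc_dilatation_le)
  define w where "w = - \<i> * Ln z"
  define a where "a = \<i> * disk_ext z"
  define b where "b = - \<i> / z"
  define J where "J = jac_BA w / (Im w)\<^sup>2"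
  have z0: "z \<noteq> 0" using z core_radius by auto
  have w: "0 < Im w" using z z0 by (simp add: w_def)
  have J: "0 < J" using jac_BA_pos[OF w] w by (simp add: J_def)
  have app: "blinfun_apply (disk_diff z) \<zeta> = a * dBA w (b * \<zeta>)" for \<zeta>
    using disk_diff_outer[OF z(1)] by (simp add: a_def b_def w_def)
  define p where "p = dBA w 1"
  define q where "q = dBA w \<i>"
  have pq: "Re p * Im q - Re q * Im p = J"
    using jac_dBA[OF w] by (simp add: p_def q_def J_def)
  have app1: "blinfun_apply (disk_diff z) 1 = a * (Re b *\<^sub>R p + Im b *\<^sub>R q)"
    using dBA_linear_combination[of w b] by (simp only: app p_def q_def mult_1_right)
  have "dBA w (b * \<i>) = Re (b * \<i>) *\<^sub>R p + Im (b * \<i>) *\<^sub>R q"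
    unfolding p_def q_def by (rule dBA_linear_combination)
  then have app2: "blinfun_apply (disk_diff z) \<i> = a * (Re b *\<^sub>R q - Im b *\<^sub>R p)"
    by (simp add: app)
  have cross: "Re (a * u) * Im (a * v) - Re (a * v) * Im (a * u) = (norm a)\<^sup>2 * (Re u * Im v - Re v * Im u)" for u v
    unfolding cmod_power2 by (simp add: power2_eq_square algebra_simps)
  have "Re (Re b *\<^sub>R p + Im b *\<^sub>R q) * Im (Re b *\<^sub>R q - Im b *\<^sub>R p)
      - Re (Re b *\<^sub>R q - Im b *\<^sub>R p) * Im (Re b *\<^sub>R p + Im b *\<^sub>R q) = (norm b)\<^sup>2 * (Re p * Im q - Re q * Im p)"
    unfolding cmod_power2 by (simp add: power2_eq_square algebra_simps)
  then have "jac (disk_diff z) = (norm a)\<^sup>2 * (norm b)\<^sup>2 * (Re p * Im q - Re q * Im p)"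
    by (simp only: jac_def app1 app2 cross mult.assoc)
  then have jac: "jac (disk_diff z) = (norm a)\<^sup>2 * (norm b)\<^sup>2 * J"
    by (simp add: pq)
  define k where "k = max 1 (dilatation_BA w)"
  have "norm (disk_diff z) \<le> sqrt (k * jac (disk_diff z))"
  proof (rule norm_blinfun_bound)
    fix \<zeta>
    have "(norm (blinfun_apply (disk_diff z) \<zeta>))\<^sup>2 = (norm a)\<^sup>2 * (norm (dBA w (b * \<zeta>)))\<^sup>2"
      by (simp add: app norm_mult power_mult_distrib)
    also have "\<dots> \<le> (norm a)\<^sup>2 * (k * J * (norm (b * \<zeta>))\<^sup>2)"
    proof (rule mult_left_mono)
      have "(norm (dBA w (b * \<zeta>)))\<^sup>2 \<le> dilatation_BA w * J * (norm (b * \<zeta>))\<^sup>2"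
        using norm_dBA[OF w] by (simp add: J_def)
      also have "\<dots> \<le> k * J * (norm (b * \<zeta>))\<^sup>2"
        using J by (intro mult_right_mono) (auto simp: k_def)
      finally show "(norm (dBA w (b * \<zeta>)))\<^sup>2 \<le> k * J * (norm (b * \<zeta>))\<^sup>2" .
    qed simp
    also have "\<dots> = k * jac (disk_diff z) * (norm \<zeta>)\<^sup>2"
      by (simp add: jac norm_mult power_mult_distrib)
    finally have "norm (blinfun_apply (disk_diff z) \<zeta>) \<le> sqrt (k * jac (disk_diff z) * (norm \<zeta>)\<^sup>2)"
      by (rule real_le_rsqrt)
    then show "norm (blinfun_apply (disk_diff z) \<zeta>) \<le> sqrt (k * jac (disk_diff z)) * norm \<zeta>"
      by (simp add: real_sqrt_mult)
  qed (use J in \<open>auto simp: jac k_def\<close>)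
  then have "(norm (disk_diff z))\<^sup>2 \<le> (sqrt (k * jac (disk_diff z)))\<^sup>2"
    by (intro power_mono) auto
  also have "\<dots> = k * jac (disk_diff z)"
    using J by (subst real_sqrt_pow2) (auto simp: jac k_def)
  finally show "(norm (disk_diff z))\<^sup>2 \<le> max 1 (dilatation_BA (- \<i> * Ln z)) * jac (disk_diff z)"
    by (simp add: k_def w_def)
qed simp

end

section \<open>Exponential integrability\<close>

text \<open>
  The Borel function agrees with \<open>g\<close> outside a null set and is made infinite on that null set.
\<close>

lemma borel_majorant:
  fixes g :: "real \<Rightarrow> real"
  assumes int: "g absolutely_integrable_on {a..b}"
  obtains G :: "real \<Rightarrow> ennreal" where "G \<in> borel_measurable borel"
    "\<And>x. x \<in> {a..b} \<Longrightarrow> ennreal (g x) \<le> G x" "(\<integral>\<^sup>+x. G x \<partial>lborel) < \<infinity>"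
proof -
  define q where "q x = indicator {a..b} x *\<^sub>R g x" for x
  have q: "integrable lebesgue q"
    using int by (simp add: set_integrable_def q_def[abs_def])
  then obtain g' where [measurable]: "g' \<in> borel_measurable borel" and g': "AE x in lborel. q x = g' x"
    using completion_ex_borel_measurable_real[of q lborel] by auto
  from g' obtain N where N: "{x. q x \<noteq> g' x} \<subseteq> N" "emeasure lborel N = 0" "N \<in> sets lborel"
    by (auto elim: AE_E)
  then have [measurable]: "N \<in> sets borel" by simp
  define G where "G x = ennreal (g' x) + \<infinity> * indicator N x" for x
  show ?thesis
  proof (rule that[of G])
    show "G \<in> borel_measurable borel" unfolding G_def by measurable
    show "ennreal (g x) \<le> G x" if "x \<in> {a..b}" for x
    proof (cases "x \<in> N")
      case False
      then have "q x = g' x" using N(1) by blast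
      then show ?thesis using that False by (simp add: G_def q_def)
    qed (simp add: G_def)
    have "(\<integral>\<^sup>+x. G x \<partial>lborel) = (\<integral>\<^sup>+x. ennreal (g' x) \<partial>lborel) + (\<integral>\<^sup>+x. \<infinity> * indicator N x \<partial>lborel)"
      unfolding G_def by (rule nn_integral_add) auto
    also have "(\<integral>\<^sup>+x. \<infinity> * indicator N x \<partial>lborel) = 0"
      using N by (subst nn_integral_cmult_indicator) auto
    also have "(\<integral>\<^sup>+x. ennreal (g' x) \<partial>lborel) = (\<integral>\<^sup>+x. ennreal (q x) \<partial>lborel)"
      using g' by (intro nn_integral_cong_AE) auto
    also have "\<dots> \<le> (\<integral>\<^sup>+x. ennreal (norm (q x)) \<partial>lebesgue)"
      unfolding nn_integral_completion by (intro nn_integral_mono ennreal_leI) simp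
    also have "\<dots> < \<infinity>" using q by (simp add: integrable_iff_bounded)
    finally show "(\<integral>\<^sup>+x. G x \<partial>lborel) < \<infinity>" by simp
  qed
qed

lemma borel_majorant_periodic:
  fixes g :: "real \<Rightarrow> real"
  assumes int: "g absolutely_integrable_on {0..2*pi}"
  obtains G :: "real \<Rightarrow> ennreal" where "G \<in> borel_measurable borel"
    "\<And>x. x \<in> {-2*pi..2*pi} \<Longrightarrow> ennreal (g (if x < 0 then x + 2 * pi else x)) \<le> G x"
    "(\<integral>\<^sup>+x. G x * indicator {-2*pi..2*pi} x \<partial>lborel) < \<infinity>"
proof -
  obtain G0 where G0[measurable]: "G0 \<in> borel_measurable borel"
    and le: "\<And>x. x \<in> {0..2*pi} \<Longrightarrow> ennreal (g x) \<le> G0 x" and fin: "(\<integral>\<^sup>+x. G0 x \<partial>lborel) < \<infinity>"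
    using borel_majorant[OF int] by blast
  define G where "G x = G0 (x + 2 * pi) + G0 x" for x
  show ?thesis
  proof (rule that[of G])
    show "G \<in> borel_measurable borel" unfolding G_def by measurable
    fix x assume "x \<in> {-2*pi..2*pi}"
    then show "ennreal (g (if x < 0 then x + 2 * pi else x)) \<le> G x"
      using le[of x] le[of "x + 2 * pi"] by (auto simp: G_def intro: add_increasing add_increasing2)
  next
    have "(\<integral>\<^sup>+x. G x * indicator {-2*pi..2*pi} x \<partial>lborel) \<le> (\<integral>\<^sup>+x. G x \<partial>lborel)"
      by (intro nn_integral_mono) (auto simp: indicator_def)
    also have "\<dots> = (\<integral>\<^sup>+x. G0 (2 * pi + 1 * x) \<partial>lborel) + (\<integral>\<^sup>+x. G0 x \<partial>lborel)"
      unfolding G_def by (subst nn_integral_add) (auto simp: add.commute)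
    also have "(\<integral>\<^sup>+x. G0 (2 * pi + 1 * x) \<partial>lborel) = (\<integral>\<^sup>+x. G0 x \<partial>lborel)"
      by (subst (2) nn_integral_real_affine[of _ 1 "2 * pi"]) auto
    also have "\<dots> + \<dots> < \<infinity>" using fin by simp
    finally show "(\<integral>\<^sup>+x. G x * indicator {-2*pi..2*pi} x \<partial>lborel) < \<infinity>" .
  qed
qed

text \<open>
  An argument of \<open>z\<close> off the imaginary axis that is a function of \<open>Im z / Re z\<close> on each of the two
  half-planes. Its range leaves room, inside \<open>{-2*pi..2*pi}\<close>, for the shifts of the centre in the
  distortion estimate.
\<close>

definition half_plane_angle :: "complex \<Rightarrow> real" where
  "half_plane_angle z = (if 0 \<le> Re z then arctan (Im z / Re z) else arctan (Im z / Re z) - pi)"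

lemma half_plane_angle_bounds: "half_plane_angle z \<in> {-3/2*pi..3/2*pi}"
  using arctan_lbound[of "Im z / Re z"] arctan_ubound[of "Im z / Re z"]
  by (auto simp: half_plane_angle_def)

lemma half_plane_angle_polar:
  assumes "Re z \<noteq> 0"
  shows "z = norm z * cis (half_plane_angle z)"
proof -
  have pos: "z = norm z * cis (arctan (Im z / Re z))" if "0 < Re z" for z
    using rcis_cmod_Arg[of z] arg_conv_arctan[OF that] by (simp add: rcis_def)
  show ?thesis
  proof (cases "0 < Re z")
    case True
    then show ?thesis using pos by (simp add: half_plane_angle_def)
  next
    case False
    then have "- z = norm z * cis (arctan (Im z / Re z))"
      using pos[of "- z"] assms by simp
    moreover have "cis (arctan (Im z / Re z) - pi) = - cis (arctan (Im z / Re z))"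
      by (simp add: cis.code complex_eq_iff cos_diff sin_diff)
    ultimately show ?thesis
      using False assms by (simp add: half_plane_angle_def) (metis minus_minus)
  qed
qed

lemma half_plane_angle_measurable[measurable]: "half_plane_angle \<in> borel_measurable borel"
  unfolding half_plane_angle_def by measurable

text \<open>
  The left half of the disk is reduced to the right half by \<open>z \<mapsto> - z\<close>.
\<close>

lemma disk_integral_finite:
  assumes [measurable]: "G \<in> borel_measurable borel"
    and fin: "(\<integral>\<^sup>+x. G x * indicator {-2*pi..2*pi} x \<partial>lborel) < \<infinity>"
  shows "(\<integral>\<^sup>+z. (1 + G (half_plane_angle z)) * ennreal ((1 - norm z) powr (-1/2)) *
     indicator {z. Re z \<noteq> 0 \<and> norm z < 1} z \<partial>lborel) < \<infinity>"
proof -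
  define G1 where "G1 x = 1 + G x" for x
  have [measurable]: "G1 \<in> borel_measurable borel" unfolding G1_def by measurable
  have "(\<integral>\<^sup>+x. G1 x * indicator {-2*pi..2*pi} x \<partial>lborel) =
     (\<integral>\<^sup>+x. 1 * indicator {-2*pi..2*pi} x \<partial>lborel) + (\<integral>\<^sup>+x. G x * indicator {-2*pi..2*pi} x \<partial>lborel)"
    unfolding G1_def distrib_right by (rule nn_integral_add) auto
  also have "\<dots> < \<infinity>" using fin by simp
  finally have fin1: "(\<integral>\<^sup>+x. G1 x * indicator {-2*pi..2*pi} x \<partial>lborel) < \<infinity>" .
  define \<phi> where "\<phi> F z = F (arctan (Im z / Re z)) * ennreal ((1 - norm z) powr (-1/2)) *
      indicator {z. 0 < Re z \<and> norm z < 1} z" for F :: "real \<Rightarrow> ennreal" and z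
  have [measurable]: "\<phi> F \<in> borel_measurable borel" if [measurable]: "F \<in> borel_measurable borel" for F
    unfolding \<phi>_def by measurable
  have right: "(\<integral>\<^sup>+z. \<phi> G1 z \<partial>lborel) < \<infinity>"
  proof -
    have "(\<integral>\<^sup>+z. \<phi> G1 z \<partial>lborel) \<le> 2 * (\<integral>\<^sup>+x. G1 x * indicator {-pi/2..pi/2} x \<partial>lborel)"
      unfolding \<phi>_def by (rule nn_integral_half_disk_le) measurable
    also have "\<dots> \<le> 2 * (\<integral>\<^sup>+x. G1 x * indicator {-2*pi..2*pi} x \<partial>lborel)"
      by (intro mult_left_mono nn_integral_mono) (auto simp: indicator_def)
    also have "\<dots> < \<infinity>" using fin1 by (simp add: ennreal_mult_less_top)
    finally show ?thesis .
  qed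
  define G2 where "G2 x = G1 (x - pi)" for x
  have [measurable]: "G2 \<in> borel_measurable borel" unfolding G2_def by measurable
  have left: "(\<integral>\<^sup>+z. \<phi> G2 (- z) \<partial>lborel) < \<infinity>"
  proof -
    have "(\<integral>\<^sup>+z. \<phi> G2 (- z) \<partial>lborel) = (\<integral>\<^sup>+z. \<phi> G2 z \<partial>lborel)"
      by (rule nn_integral_complex_uminus) measurable
    also have "\<dots> \<le> 2 * (\<integral>\<^sup>+x. G2 x * indicator {-pi/2..pi/2} x \<partial>lborel)"
      unfolding \<phi>_def by (rule nn_integral_half_disk_le) measurable
    also have "\<dots> \<le> 2 * (\<integral>\<^sup>+x. G1 (-pi + 1 * x) * indicator {-2*pi..2*pi} (-pi + 1 * x) \<partial>lborel)"
      by (intro mult_left_mono nn_integral_mono) (auto simp: indicator_def G2_def)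
    also have "(\<integral>\<^sup>+x. G1 (-pi + 1 * x) * indicator {-2*pi..2*pi} (-pi + 1 * x) \<partial>lborel) =
        (\<integral>\<^sup>+x. G1 x * indicator {-2*pi..2*pi} x \<partial>lborel)"
      by (subst (2) nn_integral_real_affine[of _ 1 "-pi"]) auto
    also have "2 * \<dots> < \<infinity>" using fin1 by (simp add: ennreal_mult_less_top)
    finally show ?thesis .
  qed
  have "(1 + G (half_plane_angle z)) * ennreal ((1 - norm z) powr (-1/2)) *
     indicator {z. Re z \<noteq> 0 \<and> norm z < 1} z = \<phi> G1 z + \<phi> G2 (- z)" for z
    by (auto simp: \<phi>_def G1_def G2_def half_plane_angle_def indicator_def)
  then show ?thesis
    using left right by (simp add: nn_integral_add)
qed

lemma nn_integral_spherical_le: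
  assumes [measurable]: "\<Phi> \<in> borel_measurable borel"
  shows "(\<integral>\<^sup>+z. \<Phi> z \<partial>spherical_measure) \<le> 4 * (\<integral>\<^sup>+z. \<Phi> z \<partial>lborel)"
proof -
  have "(\<integral>\<^sup>+z. \<Phi> z \<partial>spherical_measure) = (\<integral>\<^sup>+z. ennreal (4 / (1 + (norm z)\<^sup>2)\<^sup>2) * \<Phi> z \<partial>lebesgue)"
    unfolding spherical_measure_def by (rule nn_integral_density) (auto intro!: measurable_completion)
  also have "\<dots> \<le> (\<integral>\<^sup>+z. 4 * \<Phi> z \<partial>lebesgue)"
  proof (intro nn_integral_mono mult_right_mono)
    fix z :: complex
    have "4 / (1 + (norm z)\<^sup>2)\<^sup>2 \<le> 4 / 1"
      by (rule frac_le) (auto intro: one_le_power)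
    then have "ennreal (4 / (1 + (norm z)\<^sup>2)\<^sup>2) \<le> ennreal 4" by (intro ennreal_leI) simp
    then show "ennreal (4 / (1 + (norm z)\<^sup>2)\<^sup>2) \<le> 4" by simp
  qed simp
  also have "\<dots> = 4 * (\<integral>\<^sup>+z. \<Phi> z \<partial>lborel)"
    unfolding nn_integral_completion by (rule nn_integral_cmult) measurable
  finally show ?thesis .
qed

context circle_lift
begin

text \<open>
  The bound in the logarithmic coordinate \<open>w\<close> is transferred by \<open>1 - norm z \<le> - ln (norm z) = Im w\<close>.
  The imaginary axis, where \<open>half_plane_angle\<close> is not an argument, is given the value infinity; it is a
  null set.
\<close>

lemma exp_dilatation_integral_finite:
  fixes g :: "real \<Rightarrow> real" and G :: "real \<Rightarrow> ennreal"
  assumes M: "0 < M" and [measurable]: "G \<in> borel_measurable borel"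
    and fin: "(\<integral>\<^sup>+x. G x * indicator {-2*pi..2*pi} x \<partial>lborel) < \<infinity>"
    and C: "0 < C" "\<And>w. Re w \<in> {-3/2*pi..3/2*pi} \<Longrightarrow> 0 < Im w \<Longrightarrow> Im w \<le> 2 * pi \<Longrightarrow>
    ennreal (exp (dilatation_BA w / (640 * M))) \<le> ennreal C * (1 + G (Re w)) * ennreal (Im w powr (-1/2))"
  shows "(\<integral>\<^sup>+z\<in>ball 0 1. ennreal_exp (1 / (640 * M)) (qc_dilatation (disk_diff z)) \<partial>spherical_measure) < \<infinity>"
proof -
  define p where "p = 1 / (640 * M)"
  have p: "0 < p" using M by (simp add: p_def)
  define W where "W z = (1 + G (half_plane_angle z)) * ennreal ((1 - norm z) powr (-1/2)) *
     indicator {z. Re z \<noteq> 0 \<and> norm z < 1} z" for z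
  have [measurable]: "W \<in> borel_measurable borel" unfolding W_def by measurable
  define \<Phi> where "\<Phi> z = ennreal (exp p + C) * W z + \<infinity> * indicator {z. Re z = 0} z" for z
  have [measurable]: "\<Phi> \<in> borel_measurable borel" unfolding \<Phi>_def by measurable
  have bound: "ennreal_exp p (qc_dilatation (disk_diff z)) * indicator (ball 0 1) z \<le> \<Phi> z" for z
  proof (cases "norm z < 1 \<and> Re z \<noteq> 0")
    case False
    then show ?thesis by (cases "Re z = 0") (auto simp: \<Phi>_def indicator_def)
  next
    case True
    then have z: "norm z < 1" "z \<noteq> 0" by auto
    define v where "v = (1 - norm z) powr (-1/2)"
    have v1: "1 \<le> v"
      using z powr_mono2'[of "-1/2" "1 - norm z" 1] by (simp add: v_def)
    define E where "E = (1 + G (half_plane_angle z)) * ennreal v"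
    have W: "W z = E" using True by (simp add: W_def E_def v_def)
    have E1: "1 \<le> E"
      using mult_mono[of 1 "1 + G (half_plane_angle z)" 1 "ennreal v"] v1 by (simp add: E_def)
    have "ennreal_exp p (qc_dilatation (disk_diff z)) \<le> ennreal (exp p + C) * E"
    proof (cases "norm z < core_radius")
      case True
      have "ennreal_exp p (qc_dilatation (disk_diff z)) \<le> ennreal (exp (p * 1))"
        using qc_dilatation_inner[OF True] p by (intro ennreal_exp_le) auto
      also have "\<dots> \<le> ennreal (exp p + C) * 1"
        using C(1) by (simp add: ennreal_leI)
      also have "\<dots> \<le> ennreal (exp p + C) * E"
        using E1 by (intro mult_left_mono) auto
      finally show ?thesis .
    next
      case False
      then have cr: "core_radius \<le> norm z" by simp
      define w where "w = Complex (half_plane_angle z) (- ln (norm z))"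
      have "exp (\<i> * w) = norm z * cis (half_plane_angle z)"
        using z by (simp add: w_def exp_eq_polar)
      then have "exp (\<i> * w) = z" using half_plane_angle_polar[of z] True by simp
      then have dil: "dilatation_BA (- \<i> * Ln z) = dilatation_BA w"
        using periodic_log[of dilatation_BA w, OF dilatation_BA_period] by simp
      have "ln core_radius \<le> ln (norm z)" using cr core_radius z by (intro ln_mono) auto
      then have w2: "Im w \<le> 2 * pi" by (simp add: w_def core_radius_def)
      have w1: "0 < Im w" using z by (simp add: w_def)
      have "1 - norm z \<le> Im w"
        using ln_le_minus_one[of "norm z"] z by (simp add: w_def)
      then have yv: "Im w powr (-1/2) \<le> v"
        unfolding v_def using z by (intro powr_mono2') auto
      define k where "k = dilatation_BA w"
      have "ennreal_exp p (qc_dilatation (disk_diff z)) \<le> ennreal (exp (p * max 1 k))"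
        using qc_dilatation_outer[OF cr z(1), unfolded dil] p by (intro ennreal_exp_le) (auto simp: k_def)
      also have "\<dots> \<le> ennreal (exp p + exp (k / (640 * M)))"
      proof (rule ennreal_leI)
        have "p * k = k / (640 * M)" by (simp add: p_def)
        then show "exp (p * max 1 k) \<le> exp p + exp (k / (640 * M))"
          by (cases "1 \<le> k") (auto simp: max_def)
      qed
      also have "\<dots> = ennreal (exp p) * 1 + ennreal (exp (k / (640 * M)))"
        by simp
      also have "\<dots> \<le> ennreal (exp p) * E + ennreal C * (1 + G (Re w)) * ennreal (Im w powr (-1/2))"
        unfolding k_def using E1 w1 w2 half_plane_angle_bounds
        by (intro add_mono mult_left_mono C(2)) (auto simp: w_def)
      also have "\<dots> \<le> ennreal (exp p) * E + ennreal C * (1 + G (Re w)) * ennreal v"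
        using yv by (intro add_left_mono mult_left_mono ennreal_leI) auto
      also have "\<dots> = ennreal (exp p + C) * E"
        using C(1) by (simp add: E_def w_def distrib_right ennreal_plus mult.assoc)
      finally show ?thesis .
    qed
    then show ?thesis using z True W by (simp add: \<Phi>_def)
  qed
  have null: "(\<integral>\<^sup>+z. \<infinity> * indicator {z. Re z = 0} z \<partial>lborel) = 0"
  proof -
    have "AE z in lborel. z \<bullet> (1::complex) \<noteq> 0"
      by (rule AE_lborel_inner_neq) (simp add: Basis_complex_def)
    then show ?thesis
      by (subst nn_integral_0_iff_AE) (auto elim!: eventually_mono simp: indicator_def)
  qed
  have "(\<integral>\<^sup>+z. ennreal_exp p (qc_dilatation (disk_diff z)) * indicator (ball 0 1) z \<partial>spherical_measure)
      \<le> (\<integral>\<^sup>+z. \<Phi> z \<partial>spherical_measure)"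
    by (intro nn_integral_mono bound)
  also have "\<dots> \<le> 4 * (\<integral>\<^sup>+z. \<Phi> z \<partial>lborel)"
    by (rule nn_integral_spherical_le) measurable
  also have "(\<integral>\<^sup>+z. \<Phi> z \<partial>lborel) = ennreal (exp p + C) * (\<integral>\<^sup>+z. W z \<partial>lborel)"
  proof -
    have "(\<integral>\<^sup>+z. \<Phi> z \<partial>lborel) = (\<integral>\<^sup>+z. ennreal (exp p + C) * W z \<partial>lborel)
        + (\<integral>\<^sup>+z. \<infinity> * indicator {z. Re z = 0} z \<partial>lborel)"
      unfolding \<Phi>_def by (rule nn_integral_add) auto
    also have "(\<integral>\<^sup>+z. ennreal (exp p + C) * W z \<partial>lborel) = ennreal (exp p + C) * (\<integral>\<^sup>+z. W z \<partial>lborel)"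
      by (rule nn_integral_cmult) auto
    finally show ?thesis by (simp only: null add_0_right)
  qed
  also have "4 * (ennreal (exp p + C) * (\<integral>\<^sup>+z. W z \<partial>lborel)) < \<infinity>"
    using disk_integral_finite[OF \<open>G \<in> borel_measurable borel\<close> fin]
    by (simp add: ennreal_mult_less_top W_def)
  finally show ?thesis by (simp add: p_def)
qed

lemma finite_distortion_disk_ext:
  assumes homeo: "homeomorphism_map (ball 0 1) (ball 0 1) disk_ext"
    and orient: "orientation_preserving_on (ball 0 1) disk_ext"
  shows "finite_distortion_map (ball 0 1) (ball 0 1) disk_ext"
proof -
  have fin: "qc_dilatation (disk_diff z) < \<infinity>" if "z \<in> ball 0 1" for z
  proof (cases "norm z < core_radius")
    case True
    have "(1::ennreal) < \<infinity>" by simp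
    with qc_dilatation_inner[OF True] show ?thesis by (rule le_less_trans)
  next
    case False
    then have "qc_dilatation (disk_diff z) \<le> ennreal (max 1 (dilatation_BA (- \<i> * Ln z)))"
      using that by (intro qc_dilatation_outer) auto
    also have "\<dots> < \<infinity>" by simp
    finally show ?thesis .
  qed
  have "locally_integrable_on (ball 0 1) disk_ext"
    by (rule piecewise_locally_integrable(1)[of 0 _ 0]) (auto intro: cont_disk_ext)
  then show ?thesis
    unfolding finite_distortion_map_def sobolev_W11_loc_def
    using homeo orient weak_differential_disk_ext locally_integrable_jac fin by auto
qed

end

theorem corollary1p3:
  fixes h :: "complex \<Rightarrow> complex" and g :: "real \<Rightarrow> real"
  assumes "circle_homeo_op h"
    and "g absolutely_integrable_on {0..2 * pi}"
    and "\<And>\<theta>. \<theta> \<in> {0..2 * pi} \<Longrightarrow> 0 \<le> g \<theta>"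
    and "\<exists>M>0. \<exists>t0\<in>{0<..<pi / 2}. \<forall>\<theta>\<in>{0..2 * pi}. \<forall>t\<in>{0<..<t0}.
           circ_distortion h \<theta> t \<le> M * ln ((1 + g \<theta>) / t)"
  shows "\<exists>H. disk_extension h H \<and> exp_integrable_distortion (ball 0 1) (ball 0 1) H"
proof -
  obtain f where "continuous_on UNIV f" "strict_mono f" "\<And>x. f (x + 2 * pi) = f x + 2 * pi"
    and lift: "\<And>x. h (cis x) = cis (f x)"
    using circle_homeo_lift[OF assms(1)] by blast
  then interpret circle_lift f by unfold_locales
  obtain M t0 where M: "0 < M" and t0: "0 < t0" "t0 < pi / 2"
    and dist: "\<And>\<theta> t. \<theta> \<in> {0..2 * pi} \<Longrightarrow> t \<in> {0<..<t0} \<Longrightarrow> circ_distortion h \<theta> t \<le> M * ln ((1 + g \<theta>) / t)"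
    using assms(4) by auto
  have arc: "arc_len (h (cis a)) (h (cis b)) = f b - f a" if "a < b" "b < a + 2 * pi" for a b
  proof -
    have "f a < f b" "f b < f a + 2 * pi"
      using strict_monoD[OF mono_f, of a b] strict_monoD[OF mono_f, of b "a + 2 * pi"] that period_f[of a] by auto
    then show ?thesis
      unfolding arc_len_def lift cis_divide
      by (intro Arg2pi_unique[of 1]) (auto simp: cis_conv_exp)
  qed
  have sym: "circ_distortion h x t = sym_distortion x t" if "0 < t" "t < t0" for x t
    using that t0 pi_gt_zero by (simp add: circ_distortion_def sym_distortion_def arc)
  have sym_period: "sym_distortion (x + 2 * pi) t = sym_distortion x t" for x t
    using period_f[of x] period_f[of "x + t"] period_f[of "x - t"]
    by (simp add: sym_distortion_def algebra_simps)
  define g' where "g' x = g (if x < 0 then x + 2 * pi else x)" for x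
  obtain G where G: "G \<in> borel_measurable borel"
    "\<And>x. x \<in> {-2*pi..2*pi} \<Longrightarrow> ennreal (g' x) \<le> G x"
    "(\<integral>\<^sup>+x. G x * indicator {-2*pi..2*pi} x \<partial>lborel) < \<infinity>"
    using borel_majorant_periodic[OF assms(2)] unfolding g'_def by blast
  have g': "0 \<le> g' x" if "x \<in> {-2*pi..2*pi}" for x
    using that by (auto simp: g'_def intro!: assms(3))
  have dist': "sym_distortion x t \<le> M * ln ((1 + g' x) / t)"
    if "x \<in> {-2*pi..2*pi}" "0 < t" "t < t0" for x t
    using dist[of x t] dist[of "x + 2 * pi" t] that sym_period[of x t]
    by (auto simp: g'_def sym)
  obtain C where C: "0 < C" "\<And>w. Re w \<in> {-3/2*pi..3/2*pi} \<Longrightarrow> 0 < Im w \<Longrightarrow> Im w \<le> 2 * pi \<Longrightarrow>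
    ennreal (exp (dilatation_BA w / (640 * M))) \<le> ennreal C * (1 + G (Re w)) * ennreal (Im w powr (-1/2))"
    using exp_dilatation_BA_bound[OF M t0(1) g' dist' G(2,3)] by blast
  have on_circle: "disk_ext z = h z" if "z \<in> sphere 0 1" for z
  proof -
    have "z = cis (Arg z)" using that rcis_cmod_Arg[of z] by (simp add: rcis_def)
    then show ?thesis using disk_ext_cis lift by metis
  qed
  have "h ` sphere 0 1 = sphere 0 1"
    using assms(1) by (auto simp: circle_homeo_op_def homeomorphism_map_def homeomorphism_def)
  then have bdry: "disk_ext ` sphere 0 1 = sphere 0 1"
    using on_circle by (metis image_cong)
  note homeo = homeomorphism_disk_from_boundary[OF cont_disk_ext inj_on_disk_ext bdry disk_ext_ball]
  have "disk_ext \<circ> circlepath 0 1 = h \<circ> circlepath 0 1"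
    by (rule ext) (simp add: on_circle circlepath norm_mult)
  then have orient: "orientation_preserving_on (ball 0 1) disk_ext"
    using assms(1)
    by (intro orientation_preserving_from_boundary cont_disk_ext inj_on_disk_ext)
      (auto simp: disk_ext_def circle_homeo_op_def)
  have "disk_extension h disk_ext"
    using homeo on_circle by (simp add: disk_extension_def)
  moreover have "exp_integrable_distortion (ball 0 1) (ball 0 1) disk_ext"
    unfolding exp_integrable_distortion_def
  proof (intro conjI exI)
    show "finite_distortion_map (ball 0 1) (ball 0 1) disk_ext"
      by (rule finite_distortion_disk_ext[OF homeo(3) orient])
    show "weak_differential (ball 0 1) disk_ext disk_diff"
      by (rule weak_differential_disk_ext)
    show "0 < 1 / (640 * M)" using M by simp
    show "(\<integral>\<^sup>+z\<in>ball 0 1. ennreal_exp (1 / (640 * M)) (qc_dilatation (disk_diff z)) \<partial>spherical_measure) < \<infinity>"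
      by (rule exp_dilatation_integral_finite[OF M G(1,3) C])
  qed
  ultimately show ?thesis by blast
qed

end
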